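(* Let $\mu\in\mathcal C$ be a nonzero nilpotent bracket and let $\tilde\mu(t)$ solve the normalised bracket flow $$\tfrac{d}{dt}\tilde\mu=-\pi\big(P_{\tilde\mu}-\alpha_{\tilde\mu}\mathrm{Id}\big)\tilde\mu,\qquad\tilde\mu(0)=\mu/\|\mu\|,\qquad \alpha_{\tilde\mu}:=-\langle\pi(P_{\tilde\mu})\tilde\mu,\tilde\mu\rangle .$$ Then there is an increasing sequence of times $t_l\to\infty$ such that $\tilde\mu(t_l)$ converges, as $l\to\infty$, to a nonzero fixed point of this normalised flow.
   Context: Let $\mathfrak g$ be a real vector space of dimension $2n$ with complex structure $J$ and inner product $\langle\cdot,\cdot\rangle$ for which $J$ is orthogonal; $e_1,\dots,e_{2n}$ an orthonormal basis. A bracket is a skew-symmetric bilinear map $\nu:\mathfrak g\times\mathfrak g\to\mathfrak g$, identified with a linear map $\Lambda^2\mathfrak g\to\mathfrak g$; $\Lambda^2\mathfrak g$ carries the inner product $\langle v_1\wedge v_2,w_1\wedge w_2\rangle=\det(\langle v_i,w_j\rangle)$; brackets carry the inner product $\langle\nu,\eta\rangle=\sum_{i<j}\langle\nu(e_i,e_j),\eta(e_i,e_j)\rangle$ and norm $\|\cdot\|$. $\mathcal C$ is the set of brackets satisfying the Jacobi identity and $\nu(J\cdot,\cdot)=J\nu(\cdot,\cdot)$. For $A\in\mathrm{End}(\mathfrak g)$, $\pi(A)\nu=A\nu(\cdot,\cdot)-\nu(A\cdot,\cdot)-\nu(\cdot,A\cdot)$. $P_\nu:=\nu\nu^*$, i.e.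 $P_\nu v=\sum_{i<j}\langle v,\nu(e_i,e_j)\rangle\nu(e_i,e_j)$. *)

theory Defs
  imports "HOL-Analysis.Analysis"
begin

text \<open>The Lie algebra g is modelled as real^'n with the standard inner product;
 the standard basis axis i 1 is the orthonormal basis e_i (ordered by the linorder on 'n).
 A bracket nu is encoded by its values on basis pairs: nu $ i $ j = nu(e_i, e_j).\<close>

type_synonym 'n brk = "real ^ 'n ^ 'n ^ 'n"

definition bas :: "'n::finite \<Rightarrow> real ^ 'n" where
  "bas i = axis i 1"

definition app :: "'n::finite brk \<Rightarrow> real ^ 'n \<Rightarrow> real ^ 'n \<Rightarrow> real ^ 'n" where
  "app c x y = (\<Sum>i\<in>UNIV. \<Sum>j\<in>UNIV. (x $ i * y $ j) *\<^sub>R (c $ i $ j))"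

definition tens :: "(real ^ 'n \<Rightarrow> real ^ 'n \<Rightarrow> real ^ 'n) \<Rightarrow> 'n::finite brk" where
  "tens f = (\<chi> i j. f (bas i) (bas j))"

definition skew :: "'n::finite brk \<Rightarrow> bool" where
  "skew c \<longleftrightarrow> (\<forall>x y. app c x y = - app c y x)"

definition jacobi :: "'n::finite brk \<Rightarrow> bool" where
  "jacobi c \<longleftrightarrow> (\<forall>x y z. app c x (app c y z) + app c y (app c z x) + app c z (app c x y) = 0)"

definition in_C :: "(real ^ 'n \<Rightarrow> real ^ 'n) \<Rightarrow> 'n::finite brk \<Rightarrow> bool" where
  "in_C J c \<longleftrightarrow> skew c \<and> jacobi c \<and> (\<forall>x y. app c (J x) y = J (app c x y))"

fun iter_br :: "'n::finite brk \<Rightarrow> (real ^ 'n) list \<Rightarrow> real ^ 'n \<Rightarrow> real ^ 'n" where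
  "iter_br c [] y = y"
| "iter_br c (x # xs) y = app c x (iter_br c xs y)"

definition nilpotent_br :: "'n::finite brk \<Rightarrow> bool" where
  "nilpotent_br c \<longleftrightarrow> (\<exists>k. \<forall>xs y. length xs = k \<longrightarrow> iter_br c xs y = 0)"

definition binner :: "'n::{finite,linorder} brk \<Rightarrow> 'n brk \<Rightarrow> real" where
  "binner c d = (\<Sum>i\<in>UNIV. \<Sum>j\<in>{j. i < j}. app c (bas i) (bas j) \<bullet> app d (bas i) (bas j))"

definition bnorm :: "'n::{finite,linorder} brk \<Rightarrow> real" where
  "bnorm c = sqrt (binner c c)"

definition Pop :: "('n::{finite,linorder}) brk \<Rightarrow> real ^ ('n::{finite,linorder}) \<Rightarrow> real ^ ('n::{finite,linorder})" where
  "Pop c v = (\<Sum>i\<in>UNIV. \<Sum>j\<in>{j. i < j}. (v \<bullet> app c (bas i) (bas j)) *\<^sub>R app c (bas i) (bas j))"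

definition piop :: "(real ^ 'n \<Rightarrow> real ^ 'n) \<Rightarrow> 'n::finite brk \<Rightarrow> 'n brk" where
  "piop A c = tens (\<lambda>x y. A (app c x y) - app c (A x) y - app c x (A y))"

definition alpha :: "'n::{finite,linorder} brk \<Rightarrow> real" where
  "alpha c = - binner (piop (Pop c) c) c"

definition nflow :: "'n::{finite,linorder} brk \<Rightarrow> 'n brk" where
  "nflow c = - piop (\<lambda>v. Pop c v - alpha c *\<^sub>R v) c"

end

theory Submission
  imports Defs
begin

text \<open>
  Write \<open>P\<close> for \<open>P\<^sub>c\<close>, \<open>F(c) = - \<pi>(P)c\<close> and \<open>\<alpha> = \<langle>F(c), c\<rangle>\<close>, so that the flow is \<open>c' = F(c) - \<alpha> c\<close>
  and keeps \<open>c\<close> on the unit sphere. Undoing the normalisation amounts to a positive scale \<open>u\<close>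
  with \<open>u' = 2\<alpha>u + 1\<close>, and fixed points correspond to zeros of \<open>T = 2u F(c) + c\<close>.

  The operator \<open>Z = u T c\<^sup>*\<close> (a multiple of the derivative of \<open>u P\<close>) satisfies the identity
  \<open>Z' = T T\<^sup>* + 2 c (Z \<and> 1 + 1 \<and> Z) c\<^sup>* - Z P - P Z\<close>. A maximum principle therefore keeps
  \<open>Z \<ge> 0\<close>, a matrix Harnack inequality. It has two consequences.

  First, \<open>u\<close> is bounded: otherwise a limit bracket would be a nilpotent unit bracket with
  \<open>P\<^sup>2 \<le> c (P \<and> 1 + 1 \<and> P) c\<^sup>*\<close>; testing this on a vector of \<open>[g,g]\<close> orthogonal to
  \<open>[g,[g,g]]\<close> gives a contradiction.

  Second, taking traces, \<open>tr Z + u\<^sup>2\<close> is bounded with derivative at least \<open>\<parallel>T\<parallel>\<^sup>2\<close>, so \<open>T\<close> tends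
  to zero along a sequence of times, and compactness of the sphere yields the limit.
\<close>

section \<open>Algebra of brackets\<close>

text \<open>For skew \<open>a\<close>, \<open>b\<close> this is \<open>b a\<^sup>*\<close> as an operator through \<open>\<Lambda>\<^sup>2\<close>: the factor \<open>1/2\<close> replaces
  the restriction \<open>i < j\<close>, and likewise \<open>c \<bullet> c\<close> is twice the squared bracket norm.\<close>

definition outer_op :: "'n::finite brk \<Rightarrow> 'n brk \<Rightarrow> real ^ 'n \<Rightarrow> real ^ 'n" where
  "outer_op a b v = (1/2) *\<^sub>R (\<Sum>i\<in>UNIV. \<Sum>j\<in>UNIV. (v \<bullet> a $ i $ j) *\<^sub>R (b $ i $ j))"

definition pre_act :: "(real ^ 'n \<Rightarrow> real ^ 'n) \<Rightarrow> 'n::finite brk \<Rightarrow> 'n brk" where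
  "pre_act X c = (\<chi> i j. app c (X (bas i)) (bas j) + app c (bas i) (X (bas j)))"

definition post_act :: "(real ^ 'n \<Rightarrow> real ^ 'n) \<Rightarrow> 'n::finite brk \<Rightarrow> 'n brk" where
  "post_act X c = (\<chi> i j. X (c $ i $ j))"

definition bflow :: "'n::finite brk \<Rightarrow> 'n brk" where
  "bflow c = pre_act (outer_op c c) c - post_act (outer_op c c) c"

text \<open>The product rule for the cubic map \<open>bflow\<close> at \<open>c\<close> in direction
  \<open>d\<close>; the operator \<open>\<lambda>v. outer_op d c v + outer_op c d v\<close> is the
  variation of \<open>P\<close>.\<close>

definition bflow_deriv :: "'n::finite brk \<Rightarrow> 'n brk \<Rightarrow> 'n brk" where
  "bflow_deriv c d = pre_act (outer_op c c) d + pre_act (\<lambda>v. outer_op d c v + outer_op c d v) c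
     - post_act (outer_op c c) d - post_act (\<lambda>v. outer_op d c v + outer_op c d v) c"

text \<open>The half converts the full tensor inner product into \<open>binner\<close>, so that this
  is \<open>alpha\<close> on skew brackets.\<close>

definition bspeed :: "'n::finite brk \<Rightarrow> real" where
  "bspeed c = (bflow c \<bullet> c) / 2"

section \<open>Elementary rules for brackets and operators\<close>

lemma bilinear_app: "bilinear (app c)"
  unfolding bilinear_def app_def
  by (auto intro!: linearI simp: algebra_simps sum.distrib scaleR_sum_right)

lemmas app_simps = bilinear_ladd[OF bilinear_app] bilinear_radd[OF bilinear_app]
  bilinear_lmul[OF bilinear_app] bilinear_rmul[OF bilinear_app]
  bilinear_lneg[OF bilinear_app] bilinear_rneg[OF bilinear_app]
  bilinear_lsub[OF bilinear_app] bilinear_rsub[OF bilinear_app]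
  bilinear_lzero[OF bilinear_app] bilinear_rzero[OF bilinear_app]

lemma app_add_brk: "app (c + d) x y = app c x y + app d x y"
  by (simp add: app_def algebra_simps sum.distrib)

lemma app_scaleR_brk: "app (k *\<^sub>R c) x y = k *\<^sub>R app c x y"
  by (simp add: app_def scaleR_sum_right mult.commute mult.left_commute)

lemma sum_delta_scaleR:
  fixes f :: "'i::finite \<Rightarrow> 'a::real_vector"
  shows "(\<Sum>i\<in>UNIV. (if i = k then x else 0) *\<^sub>R f i) = x *\<^sub>R f k"
  by (simp add: if_distrib[of "\<lambda>x. x *\<^sub>R _"] cong: if_cong)

lemma app_bas_left: "app c (bas i) y = (\<Sum>j\<in>UNIV. (y $ j) *\<^sub>R (c $ i $ j))"
proof -
  have "app c (bas i) y = (\<Sum>k\<in>UNIV. (if k = i then 1 else 0) *\<^sub>R (\<Sum>j\<in>UNIV. (y $ j) *\<^sub>R (c $ k $ j)))"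
    unfolding app_def bas_def axis_def by (intro sum.cong refl) (auto simp: scaleR_sum_right)
  then show ?thesis by (simp only: sum_delta_scaleR scaleR_one)
qed

lemma app_bas_bas [simp]: "app c (bas i) (bas j) = c $ i $ j"
proof -
  have "app c (bas i) (bas j) = (\<Sum>k\<in>UNIV. (if k = j then 1 else 0) *\<^sub>R (c $ i $ k))"
    unfolding app_bas_left by (intro sum.cong refl) (auto simp: bas_def axis_def)
  then show ?thesis by (simp only: sum_delta_scaleR scaleR_one)
qed

lemma vec_eq_sum_bas: "x = (\<Sum>i\<in>UNIV. (x $ i) *\<^sub>R bas i)"
  by (simp add: vec_eq_iff bas_def axis_def if_distrib cong: if_cong)

lemma inner_bas: "x \<bullet> bas i = x $ i"
  by (simp add: bas_def inner_axis)

lemma pre_act_nth: "pre_act X c $ i $ j = app c (X (bas i)) (bas j) + app c (bas i) (X (bas j))"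
  by (simp add: pre_act_def)

lemma post_act_nth: "post_act X c $ i $ j = X (c $ i $ j)"
  by (simp add: post_act_def)

lemma pre_act_op_linear:
  "pre_act (\<lambda>v. X v + Y v) c = pre_act X c + pre_act Y c"
  "pre_act (\<lambda>v. k *\<^sub>R X v) c = k *\<^sub>R pre_act X c"
  by (simp_all add: vec_eq_iff pre_act_nth app_simps algebra_simps)

lemma outer_op_linear:
  "outer_op (a + a') b v = outer_op a b v + outer_op a' b v"
  "outer_op (k *\<^sub>R a) b v = k *\<^sub>R outer_op a b v"
  "outer_op a (b + b') v = outer_op a b v + outer_op a b' v"
  "outer_op a (k *\<^sub>R b) v = k *\<^sub>R outer_op a b v"
  "outer_op a b (v + w) = outer_op a b v + outer_op a b w"
  "outer_op a b (k *\<^sub>R v) = k *\<^sub>R outer_op a b v"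
  by (simp_all add: outer_op_def inner_add_left inner_add_right scaleR_add_left scaleR_add_right
      sum.distrib scaleR_sum_right mult.commute mult.left_commute)

lemma outer_op_minus:
  "outer_op (a - a') b v = outer_op a b v - outer_op a' b v"
  "outer_op a (b - b') v = outer_op a b v - outer_op a b' v"
  by (simp_all add: outer_op_def inner_diff_right algebra_simps sum_subtractf)

lemma linear_outer_op: "linear (outer_op a b)"
  by (intro linearI) (simp_all add: outer_op_linear)

lemma outer_op_inner:
  "outer_op a b v \<bullet> w = (\<Sum>i\<in>UNIV. \<Sum>j\<in>UNIV. (v \<bullet> a $ i $ j) * (w \<bullet> b $ i $ j)) / 2"
  by (simp add: outer_op_def inner_sum_left) (simp add: inner_commute)

lemma outer_op_adjoint: "outer_op a b v \<bullet> w = v \<bullet> outer_op b a w"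
  by (simp add: outer_op_inner inner_commute[of v "outer_op b a w"] mult.commute)

lemma outer_op_post_act:
  assumes "\<And>v w. X v \<bullet> w = v \<bullet> X w"
  shows "outer_op a (post_act X b) v \<bullet> w = outer_op a b v \<bullet> X w"
  by (simp add: outer_op_inner post_act_nth assms)

section \<open>Moving operators through contractions\<close>

lemma linear_functional_eq_inner:
  fixes f :: "real ^ 'n \<Rightarrow> real"
  assumes "linear f"
  shows "f x = x \<bullet> (\<chi> i. f (bas i))"
proof -
  have "f x = f (\<Sum>i\<in>UNIV. (x $ i) *\<^sub>R bas i)"
    using vec_eq_sum_bas[of x] by simp
  also have "\<dots> = (\<Sum>i\<in>UNIV. x $ i * f (bas i))"
    by (simp add: linear_sum[OF assms] linear_scale[OF assms])
  finally show ?thesis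
    by (simp add: inner_vec_def)
qed

text \<open>A linear functional is represented by its vector of basis values, so a contraction over
  one bracket slot becomes a statement about \<open>X\<close> alone.\<close>

lemma sum_functionals_eq_inner:
  fixes f g :: "real ^ 'n \<Rightarrow> real"
  assumes "linear f" "linear g" "linear X"
  shows "(\<Sum>i\<in>UNIV. f (X (bas i)) * g (bas i)) = X (\<chi> i. g (bas i)) \<bullet> (\<chi> i. f (bas i))"
proof -
  have "linear (\<lambda>x. f (X x))"
    using linear_compose[OF assms(3,1)] by (simp add: o_def)
  then have "f (X (\<chi> i. g (bas i))) = (\<chi> i. g (bas i)) \<bullet> (\<chi> i. f (X (bas i)))"
    by (rule linear_functional_eq_inner)
  then show ?thesis
    using linear_functional_eq_inner[OF assms(1), of "X (\<chi> i. g (bas i))"]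
    by (simp add: inner_vec_def mult.commute)
qed

lemma linear_inner_app:
  "linear (\<lambda>x. v \<bullet> app c x y)" "linear (\<lambda>y. v \<bullet> app c x y)"
  by (auto intro!: linearI simp: app_simps inner_add_right)

lemma sum_functionals_adjoint:
  fixes f g :: "real ^ 'n \<Rightarrow> real"
  assumes f: "linear f" and g: "linear g" and X: "linear X" and sa: "\<And>v w. X v \<bullet> w = v \<bullet> X w"
  shows "(\<Sum>i\<in>UNIV. f (X (bas i)) * g (bas i)) = (\<Sum>i\<in>UNIV. f (bas i) * g (X (bas i)))"
  using sum_functionals_eq_inner[OF f g X] sum_functionals_eq_inner[OF g f X]
    sa[of "\<chi> i. f (bas i)" "\<chi> i. g (bas i)"]
  by (simp add: mult.commute inner_commute)

text \<open>\<open>pre_act X c\<close> is \<open>c\<close> composed with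
  \<open>X \<and> 1 + 1 \<and> X\<close>, which is self-adjoint when \<open>X\<close> is, so it can
  be moved from one factor of \<open>b a\<^sup>*\<close> to the other. The two slots are treated
  separately.\<close>

lemma outer_op_pre_act:
  assumes X: "linear X" and sa: "\<And>v w. X v \<bullet> w = v \<bullet> X w"
  shows "outer_op (pre_act X a) b v \<bullet> w = outer_op a (pre_act X b) v \<bullet> w"
proof -
  note adj = sum_functionals_adjoint[OF _ _ X sa]
  have 1: "(\<Sum>i\<in>UNIV. \<Sum>j\<in>UNIV. (v \<bullet> app a (X (bas i)) (bas j)) * (w \<bullet> b $ i $ j))
      = (\<Sum>i\<in>UNIV. \<Sum>j\<in>UNIV. (v \<bullet> a $ i $ j) * (w \<bullet> app b (X (bas i)) (bas j)))"
    using adj[OF linear_inner_app(1) linear_inner_app(1), of v a "bas j" w b "bas j" for j]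
    by (subst (1 2) sum.swap) simp
  have 2: "(\<Sum>i\<in>UNIV. \<Sum>j\<in>UNIV. (v \<bullet> app a (bas i) (X (bas j))) * (w \<bullet> b $ i $ j))
      = (\<Sum>i\<in>UNIV. \<Sum>j\<in>UNIV. (v \<bullet> a $ i $ j) * (w \<bullet> app b (bas i) (X (bas j))))"
    using adj[OF linear_inner_app(2) linear_inner_app(2), of v a "bas j" w b "bas j" for j]
    by simp
  show ?thesis
    using 1 2
    by (simp add: outer_op_inner pre_act_nth inner_add_right distrib_left distrib_right sum.distrib)
qed

text \<open>For a fixed second index the first slot contributes \<open>X y \<bullet> y\<close>,
  where \<open>y\<close> lists the numbers \<open>v \<bullet> c $ i $ j\<close>; the second slot is
  analogous. Thus \<open>c (X \<and> 1 + 1 \<and> X) c\<^sup>*\<close> inherits positivity from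
  \<open>X\<close>.\<close>

lemma outer_op_pre_act_nonneg:
  assumes X: "linear X" and psd: "\<And>v. X v \<bullet> v \<ge> 0"
  shows "outer_op c (pre_act X c) v \<bullet> v \<ge> 0"
proof -
  note eq = sum_functionals_eq_inner[OF _ _ X]
  have 1: "(\<Sum>i\<in>UNIV. (v \<bullet> c $ i $ j) * (v \<bullet> app c (X (bas i)) (bas j))) \<ge> 0" for j
    using eq[OF linear_inner_app(1) linear_inner_app(1), of v c "bas j" v c "bas j"] psd
    by (simp add: mult.commute)
  have 2: "(\<Sum>j\<in>UNIV. (v \<bullet> c $ i $ j) * (v \<bullet> app c (bas i) (X (bas j)))) \<ge> 0" for i
    using eq[OF linear_inner_app(2) linear_inner_app(2), of v c "bas i" v c "bas i"] psd
    by (simp add: mult.commute)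
  have "(\<Sum>i\<in>UNIV. \<Sum>j\<in>UNIV. (v \<bullet> c $ i $ j) * (v \<bullet> app c (X (bas i)) (bas j))) \<ge> 0"
    by (subst sum.swap) (intro sum_nonneg 1)
  moreover have "(\<Sum>i\<in>UNIV. \<Sum>j\<in>UNIV. (v \<bullet> c $ i $ j) * (v \<bullet> app c (bas i) (X (bas j)))) \<ge> 0"
    by (intro sum_nonneg 2)
  ultimately show ?thesis
    by (simp add: outer_op_inner pre_act_nth inner_add_right distrib_left sum.distrib)
qed

section \<open>Trace and positivity estimates\<close>

lemma outer_op_self_nonneg: "outer_op c c v \<bullet> v \<ge> 0"
  by (simp add: outer_op_inner sum_nonneg)

lemma outer_op_trace: "(\<Sum>k\<in>UNIV. outer_op a b (bas k) \<bullet> bas k) = (a \<bullet> b) / 2"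
proof -
  have "(\<Sum>k\<in>UNIV. outer_op a b (bas k) \<bullet> bas k)
      = (\<Sum>k\<in>UNIV. \<Sum>i\<in>UNIV. \<Sum>j\<in>UNIV. a $ i $ j $ k * b $ i $ j $ k) / 2"
    by (simp add: outer_op_inner inner_commute[of "bas _" "_ $ _ $ _"] sum_divide_distrib del: inner_bas)
      (simp add: inner_bas)
  also have "\<dots> = (\<Sum>i\<in>UNIV. \<Sum>k\<in>UNIV. \<Sum>j\<in>UNIV. a $ i $ j $ k * b $ i $ j $ k) / 2"
    by (subst sum.swap) simp
  also have "\<dots> = (\<Sum>i\<in>UNIV. \<Sum>j\<in>UNIV. \<Sum>k\<in>UNIV. a $ i $ j $ k * b $ i $ j $ k) / 2"
    by (subst (2) sum.swap) simp
  finally show ?thesis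
    by (simp add: inner_vec_def)
qed

lemma outer_op_self_le:
  "outer_op c c v \<bullet> v \<le> (c \<bullet> c) / 2 * (v \<bullet> v)"
proof -
  have "(v \<bullet> c $ i $ j) * (v \<bullet> c $ i $ j) \<le> (v \<bullet> v) * (c $ i $ j \<bullet> c $ i $ j)" for i j
    using Cauchy_Schwarz_ineq[of v "c $ i $ j"] by (simp add: power2_eq_square)
  then have "(\<Sum>i\<in>UNIV. \<Sum>j\<in>UNIV. (v \<bullet> c $ i $ j) * (v \<bullet> c $ i $ j))
      \<le> (\<Sum>i\<in>UNIV. \<Sum>j\<in>UNIV. (v \<bullet> v) * (c $ i $ j \<bullet> c $ i $ j))"
    by (intro sum_mono)
  also have "\<dots> = (v \<bullet> v) * (c \<bullet> c)"
    by (simp add: inner_vec_def[of c c] inner_vec_def[of "c $ _" "c $ _"] sum_distrib_left)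
  finally show ?thesis
    by (simp add: outer_op_inner mult.commute)
qed

lemma psd_Cauchy_Schwarz:
  fixes X :: "'a::real_inner \<Rightarrow> 'a"
  assumes X: "linear X" and sa: "\<And>v w. X v \<bullet> w = v \<bullet> X w" and psd: "\<And>v. X v \<bullet> v \<ge> 0"
  shows "(X v \<bullet> w)\<^sup>2 \<le> (X v \<bullet> v) * (X w \<bullet> w)"
proof -
  have q: "(X v \<bullet> v) + 2 * t * (X v \<bullet> w) + t\<^sup>2 * (X w \<bullet> w) \<ge> 0" for t
  proof -
    have "X w \<bullet> v = X v \<bullet> w" using sa[of w v] by (simp add: inner_commute)
    then have "X (v + t *\<^sub>R w) \<bullet> (v + t *\<^sub>R w)
        = (X v \<bullet> v) + 2 * t * (X v \<bullet> w) + t\<^sup>2 * (X w \<bullet> w)"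
      by (simp add: linear_add[OF X] linear_scale[OF X] inner_add_left inner_add_right
          power2_eq_square algebra_simps)
    then show ?thesis using psd[of "v + t *\<^sub>R w"] by simp
  qed
  show ?thesis
  proof (cases "X w \<bullet> w = 0")
    case True
    have "X v \<bullet> w = 0"
    proof (rule ccontr)
      assume n: "X v \<bullet> w \<noteq> 0"
      \<comment> \<open>With \<open>X w \<bullet> w = 0\<close> the quadratic is affine in
        \<open>t\<close>, and this \<open>t\<close> gives it the value \<open>-1\<close>.\<close>
      show False
        using q[of "- (X v \<bullet> v + 1) / (2 * (X v \<bullet> w))"] True n by (simp add: field_simps)
    qed
    then show ?thesis using True by simp
  next
    case False
    then have pos: "X w \<bullet> w > 0" using psd[of w] by simp
    \<comment> \<open>The quadratic at its minimiser, multiplied by its leading coefficient.\<close>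
    have "0 \<le> (X w \<bullet> w) * ((X v \<bullet> v) + 2 * (- (X v \<bullet> w) / (X w \<bullet> w)) * (X v \<bullet> w)
        + (- (X v \<bullet> w) / (X w \<bullet> w))\<^sup>2 * (X w \<bullet> w))"
      using q[of "- (X v \<bullet> w) / (X w \<bullet> w)"] pos by (intro mult_nonneg_nonneg) simp_all
    also have "\<dots> = (X v \<bullet> v) * (X w \<bullet> w) - (X v \<bullet> w)\<^sup>2"
      using pos by (simp add: field_simps power2_eq_square)
    finally show ?thesis by simp
  qed
qed

text \<open>No diagonalisation: Cauchy-Schwarz for the form of \<open>X\<close> bounds each matrix
  entry by the square roots of two diagonal entries, and Cauchy-Schwarz for sums does the
  rest.\<close>

lemma psd_le_trace:
  fixes X :: "real ^ 'n \<Rightarrow> real ^ 'n"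
  assumes X: "linear X" and sa: "\<And>v w. X v \<bullet> w = v \<bullet> X w" and psd: "\<And>v. X v \<bullet> v \<ge> 0"
  shows "X w \<bullet> w \<le> (\<Sum>k\<in>UNIV. X (bas k) \<bullet> bas k) * (w \<bullet> w)"
proof -
  let ?z = "\<lambda>k. X (bas k) \<bullet> bas k"
  have e: "X (bas i) \<bullet> bas j \<le> sqrt (?z i) * sqrt (?z j)" "- (X (bas i) \<bullet> bas j) \<le> sqrt (?z i) * sqrt (?z j)" for i j
    using real_sqrt_le_mono[OF psd_Cauchy_Schwarz[OF assms, of "bas i" "bas j"]]
    by (auto simp: real_sqrt_mult)
  have "X w = (\<Sum>i\<in>UNIV. (w $ i) *\<^sub>R X (bas i))"
    by (subst vec_eq_sum_bas[of w]) (simp add: linear_sum[OF X] linear_scale[OF X])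
  then have "X w \<bullet> w = (\<Sum>i\<in>UNIV. w $ i * (X (bas i) \<bullet> w))"
    by (simp add: inner_sum_left)
  also have "\<dots> = (\<Sum>i\<in>UNIV. w $ i * (X (bas i) \<bullet> (\<Sum>j\<in>UNIV. (w $ j) *\<^sub>R bas j)))"
    using vec_eq_sum_bas[of w] by simp
  also have "\<dots> = (\<Sum>i\<in>UNIV. \<Sum>j\<in>UNIV. w $ i * (w $ j * (X (bas i) \<bullet> bas j)))"
    by (simp add: inner_sum_right sum_distrib_left)
  also have "\<dots> \<le> (\<Sum>i\<in>UNIV. \<Sum>j\<in>UNIV. (\<bar>w $ i\<bar> * sqrt (?z i)) * (\<bar>w $ j\<bar> * sqrt (?z j)))"
  proof (intro sum_mono)
    fix i j
    have "w $ i * (w $ j * (X (bas i) \<bullet> bas j)) \<le> \<bar>w $ i\<bar> * (\<bar>w $ j\<bar> * \<bar>X (bas i) \<bullet> bas j\<bar>)"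
      by (metis abs_ge_self abs_mult)
    also have "\<dots> \<le> \<bar>w $ i\<bar> * (\<bar>w $ j\<bar> * (sqrt (?z i) * sqrt (?z j)))"
      using e[of i j] by (intro mult_left_mono) auto
    finally show "w $ i * (w $ j * (X (bas i) \<bullet> bas j)) \<le> (\<bar>w $ i\<bar> * sqrt (?z i)) * (\<bar>w $ j\<bar> * sqrt (?z j))"
      by (simp add: mult_ac)
  qed
  also have "\<dots> = (\<Sum>i\<in>UNIV. \<bar>w $ i\<bar> * sqrt (?z i))\<^sup>2"
    by (simp add: power2_eq_square sum_product)
  also have "\<dots> \<le> (\<Sum>i\<in>UNIV. \<bar>w $ i\<bar>\<^sup>2) * (\<Sum>i\<in>UNIV. (sqrt (?z i))\<^sup>2)"
    by (rule Cauchy_Schwarz_ineq_sum)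
  also have "\<dots> = (\<Sum>k\<in>UNIV. ?z k) * (w \<bullet> w)"
    by (simp add: psd inner_vec_def[of w w] power2_eq_square)
  finally show ?thesis .
qed

text \<open>The trace of \<open>X P\<close> is half the sum of
  \<open>X (c $ i $ j) \<bullet> c $ i $ j\<close>, and \<open>X \<le> tr X\<close> applies to each
  term. This controls the negative terms \<open>- Z P - P Z\<close> in the energy estimate.\<close>

lemma trace_mult_outer_op_le:
  fixes X :: "real ^ 'n \<Rightarrow> real ^ 'n"
  assumes X: "linear X" and sa: "\<And>v w. X v \<bullet> w = v \<bullet> X w" and psd: "\<And>v. X v \<bullet> v \<ge> 0"
  shows "(\<Sum>k\<in>UNIV. X (bas k) \<bullet> outer_op c c (bas k))
    \<le> (\<Sum>k\<in>UNIV. X (bas k) \<bullet> bas k) * ((c \<bullet> c) / 2)"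
proof -
  let ?t = "\<Sum>k\<in>UNIV. X (bas k) \<bullet> bas k"
  have "(\<Sum>k\<in>UNIV. X (bas k) \<bullet> outer_op c c (bas k)) = (\<Sum>k\<in>UNIV. outer_op c (post_act X c) (bas k) \<bullet> bas k)"
    by (simp add: outer_op_post_act[OF sa]) (simp add: inner_commute)
  also have "\<dots> = (c \<bullet> post_act X c) / 2"
    by (rule outer_op_trace)
  also have "c \<bullet> post_act X c = (\<Sum>i\<in>UNIV. \<Sum>j\<in>UNIV. X (c $ i $ j) \<bullet> c $ i $ j)"
    by (simp add: inner_vec_def[of c] inner_vec_def[of "c $ _" "post_act X c $ _"] post_act_nth inner_commute)
  also have "\<dots> \<le> (\<Sum>i\<in>UNIV. \<Sum>j\<in>UNIV. ?t * (c $ i $ j \<bullet> c $ i $ j))"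
    by (intro sum_mono psd_le_trace[OF assms])
  also have "\<dots> = ?t * (c \<bullet> c)"
    by (simp add: inner_vec_def[of c c] inner_vec_def[of "c $ _" "c $ _"] sum_distrib_left)
  finally show ?thesis by simp
qed

text \<open>Since \<open>tr P = 1\<close>, also \<open>P \<le> 1\<close>. Cauchy-Schwarz for the
  form of \<open>P\<close> at \<open>v\<close> and \<open>P v\<close> then allows one factor
  \<open>P v \<bullet> P v\<close> to be cancelled.\<close>

lemma outer_op_self_contract:
  assumes "c \<bullet> c = 2"
  shows "outer_op c c v \<bullet> outer_op c c v \<le> outer_op c c v \<bullet> v"
proof -
  let ?P = "outer_op c c" let ?n = "?P v \<bullet> ?P v"
  have "?n\<^sup>2 \<le> (?P v \<bullet> v) * (?P (?P v) \<bullet> ?P v)"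
    by (rule psd_Cauchy_Schwarz) (simp_all add: linear_outer_op outer_op_adjoint outer_op_self_nonneg
      flip: outer_op_adjoint)
  also have "\<dots> \<le> (?P v \<bullet> v) * ?n"
    using outer_op_self_le[of c "?P v"] assms by (intro mult_left_mono outer_op_self_nonneg) simp
  finally have "?n * ?n \<le> (?P v \<bullet> v) * ?n" by (simp add: power2_eq_square)
  then show ?thesis
    by (cases "?n = 0") (auto simp: outer_op_self_nonneg mult_le_cancel_right)
qed

section \<open>Differentiation along curves of brackets\<close>

lemma has_vector_derivative_vec_nth:
  assumes "(c has_vector_derivative c') F"
  shows "((\<lambda>t. c t $ i) has_vector_derivative c' $ i) F"
  by (rule bounded_linear.has_vector_derivative[OF bounded_linear_vec_nth assms])

lemma has_vector_derivative_app:
  assumes "(c has_vector_derivative c') (at s within S)"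
    and "(x has_vector_derivative x') (at s within S)"
    and "(y has_vector_derivative y') (at s within S)"
  shows "((\<lambda>t. app (c t) (x t) (y t)) has_vector_derivative
    app c' (x s) (y s) + app (c s) x' (y s) + app (c s) (x s) y') (at s within S)"
proof -
  note n = has_vector_derivative_vec_nth
  have m: "((\<lambda>t. x t $ i * y t $ j) has_real_derivative x' $ i * y s $ j + x s $ i * y' $ j) (at s within S)" for i j
    using n[OF assms(2), of i] n[OF assms(3), of j]
    by (auto intro!: derivative_eq_intros simp: has_real_derivative_iff_has_vector_derivative[symmetric] algebra_simps)
  have "((\<lambda>t. app (c t) (x t) (y t)) has_vector_derivative
     (\<Sum>i\<in>UNIV. \<Sum>j\<in>UNIV. (x s $ i * y s $ j) *\<^sub>R c' $ i $ j
        + (x' $ i * y s $ j + x s $ i * y' $ j) *\<^sub>R c s $ i $ j)) (at s within S)"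
    unfolding app_def
    by (intro has_vector_derivative_sum has_vector_derivative_scaleR m n[OF n[OF assms(1)]])
  also have "(\<Sum>i\<in>UNIV. \<Sum>j\<in>UNIV. (x s $ i * y s $ j) *\<^sub>R c' $ i $ j
        + (x' $ i * y s $ j + x s $ i * y' $ j) *\<^sub>R c s $ i $ j)
      = app c' (x s) (y s) + app (c s) x' (y s) + app (c s) (x s) y'"
    by (simp add: app_def scaleR_add_left sum.distrib)
  finally show ?thesis .
qed

lemma has_real_derivative_inner:
  assumes "(x has_vector_derivative x') (at s within S)"
    and "(y has_vector_derivative y') (at s within S)"
  shows "((\<lambda>t. x t \<bullet> y t) has_real_derivative x' \<bullet> y s + x s \<bullet> y') (at s within S)"
  unfolding has_real_derivative_iff_has_vector_derivative
  using bounded_bilinear.has_vector_derivative[OF bounded_bilinear_inner assms]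
  by (simp add: add.commute)

text \<open>The second bracket is differentiated entry by entry, because
  \<open>has_vector_derivative_bflow_nth\<close> supplies the derivative of \<open>bflow\<close> in
  that form.\<close>

lemma has_vector_derivative_outer_op:
  assumes "(a has_vector_derivative a') (at s within S)"
    and "\<And>i j. ((\<lambda>t. b t $ i $ j) has_vector_derivative b' $ i $ j) (at s within S)"
    and "(v has_vector_derivative v') (at s within S)"
  shows "((\<lambda>t. outer_op (a t) (b t) (v t)) has_vector_derivative
    outer_op a' (b s) (v s) + outer_op (a s) b' (v s) + outer_op (a s) (b s) v') (at s within S)"
proof -
  note n = has_vector_derivative_vec_nth
  have m: "((\<lambda>t. v t \<bullet> a t $ i $ j) has_real_derivative v' \<bullet> a s $ i $ j + v s \<bullet> a' $ i $ j) (at s within S)" for i j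
    by (rule has_real_derivative_inner[OF assms(3) n[OF n[OF assms(1)]]])
  have "((\<lambda>t. outer_op (a t) (b t) (v t)) has_vector_derivative
     (1/2) *\<^sub>R (\<Sum>i\<in>UNIV. \<Sum>j\<in>UNIV. (v s \<bullet> a s $ i $ j) *\<^sub>R b' $ i $ j
        + (v' \<bullet> a s $ i $ j + v s \<bullet> a' $ i $ j) *\<^sub>R b s $ i $ j)) (at s within S)"
    unfolding outer_op_def
    by (rule bounded_linear.has_vector_derivative[OF bounded_linear_scaleR_right])
       (intro has_vector_derivative_sum has_vector_derivative_scaleR m assms(2))
  also have "(1/2) *\<^sub>R (\<Sum>i\<in>UNIV. \<Sum>j\<in>UNIV. (v s \<bullet> a s $ i $ j) *\<^sub>R b' $ i $ j
        + (v' \<bullet> a s $ i $ j + v s \<bullet> a' $ i $ j) *\<^sub>R b s $ i $ j)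
      = outer_op a' (b s) (v s) + outer_op (a s) b' (v s) + outer_op (a s) (b s) v'"
    by (simp add: outer_op_def scaleR_add_left scaleR_add_right sum.distrib)
  finally show ?thesis .
qed

lemma has_vector_derivative_bflow_nth:
  assumes c: "(c has_vector_derivative c') (at s within S)"
  shows "((\<lambda>t. bflow (c t) $ i $ j) has_vector_derivative bflow_deriv (c s) c' $ i $ j) (at s within S)"
proof -
  note n = has_vector_derivative_vec_nth
  note k = has_vector_derivative_const
  note o = has_vector_derivative_outer_op[OF c n[OF n[OF c]]]
  note a = has_vector_derivative_app[OF c]
  have "((\<lambda>t. app (c t) (outer_op (c t) (c t) (bas i)) (bas j) + app (c t) (bas i) (outer_op (c t) (c t) (bas j))
      - outer_op (c t) (c t) (c t $ i $ j)) has_vector_derivative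
    (app c' (outer_op (c s) (c s) (bas i)) (bas j)
      + app (c s) (outer_op c' (c s) (bas i) + outer_op (c s) c' (bas i) + outer_op (c s) (c s) 0) (bas j)
      + app (c s) (outer_op (c s) (c s) (bas i)) 0)
    + (app c' (bas i) (outer_op (c s) (c s) (bas j)) + app (c s) 0 (outer_op (c s) (c s) (bas j))
      + app (c s) (bas i) (outer_op c' (c s) (bas j) + outer_op (c s) c' (bas j) + outer_op (c s) (c s) 0))
    - (outer_op c' (c s) (c s $ i $ j) + outer_op (c s) c' (c s $ i $ j) + outer_op (c s) (c s) (c' $ i $ j)))
    (at s within S)"
    by (intro has_vector_derivative_diff has_vector_derivative_add a[OF o[OF k] k] a[OF k o[OF k]] o[OF n[OF n[OF c]]])
  then show ?thesis
    by (simp add: bflow_def bflow_deriv_def pre_act_nth post_act_nth app_simps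
        linear_0[OF linear_outer_op] algebra_simps)
qed

lemma bflow_deriv_linear:
  "bflow_deriv c (d + d') = bflow_deriv c d + bflow_deriv c d'"
  "bflow_deriv c (k *\<^sub>R d) = k *\<^sub>R bflow_deriv c d"
  by (simp_all add: bflow_deriv_def vec_eq_iff pre_act_nth post_act_nth app_add_brk app_scaleR_brk
      app_simps outer_op_linear algebra_simps)

text \<open>Euler's identity: \<open>bflow\<close> is homogeneous of degree 3.\<close>

lemma bflow_deriv_self: "bflow_deriv c c = 3 *\<^sub>R bflow c"
proof -
  have "(\<lambda>v. outer_op c c v + outer_op c c v) = (\<lambda>v. 2 *\<^sub>R outer_op c c v)"
    by (simp add: scaleR_2)
  then show ?thesis
    by (simp add: bflow_deriv_def bflow_def vec_eq_iff pre_act_nth post_act_nth app_simps)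
qed

section \<open>Symmetry of the Harnack operator and its evolution identity\<close>

lemma outer_op_self_adjoint: "outer_op c c v \<bullet> w = v \<bullet> outer_op c c w"
  by (rule outer_op_adjoint)

text \<open>The \<open>pre_act\<close> part of \<open>F(c)\<close> gives
  \<open>c (P \<and> 1 + 1 \<and> P) c\<^sup>*\<close> and the \<open>post_act\<close> part gives
  \<open>P\<^sup>2\<close>. The sign of this difference is what the nilpotency argument
  tests.\<close>

lemma outer_op_bflow:
  "outer_op c (bflow c) v \<bullet> w
    = outer_op c (pre_act (outer_op c c) c) v \<bullet> w - outer_op c c v \<bullet> outer_op c c w"
  by (simp add: bflow_def outer_op_minus inner_diff_left outer_op_post_act[OF outer_op_self_adjoint])

text \<open>Both parts of \<open>F(c) c\<^sup>*\<close> are self-adjoint. This is the source of the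
  self-adjointness of \<open>Z\<close>.\<close>

lemma outer_op_bflow_commute: "outer_op (bflow c) c = outer_op c (bflow c)"
proof
  fix v
  have "outer_op (bflow c) c v \<bullet> w = outer_op c (bflow c) v \<bullet> w" for w
  proof -
    have "outer_op (bflow c) c v \<bullet> w = outer_op c (bflow c) w \<bullet> v"
      by (metis outer_op_adjoint inner_commute)
    also have "\<dots> = outer_op c (pre_act (outer_op c c) c) w \<bullet> v - outer_op c c w \<bullet> outer_op c c v"
      by (rule outer_op_bflow)
    also have "outer_op c (pre_act (outer_op c c) c) w \<bullet> v = outer_op c (pre_act (outer_op c c) c) v \<bullet> w"
      by (metis outer_op_pre_act[OF linear_outer_op outer_op_self_adjoint] outer_op_adjoint inner_commute)
    finally show ?thesis
      by (simp add: outer_op_bflow inner_commute[of "outer_op c c w"])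
  qed
  then show "outer_op (bflow c) c v = outer_op c (bflow c) v"
    by (meson vector_eq_rdot)
qed

lemma outer_op_harnack_commute:
  "outer_op (k *\<^sub>R bflow c + c) c = outer_op c (k *\<^sub>R bflow c + c)"
  by (simp add: fun_eq_iff outer_op_linear outer_op_bflow_commute)

text \<open>The identity for \<open>Z'\<close> as pure algebra: \<open>d\<close>, \<open>u'\<close>
  and the bracket \<open>(2 * u') *\<^sub>R bflow c + (2 * u) *\<^sub>R bflow_deriv c d + d\<close>
  stand for the derivatives of \<open>c\<close>, \<open>u\<close> and \<open>T\<close>. Both
  \<open>2 u d\<close> and \<open>2 u F(c)\<close> are combinations of \<open>T\<close> and
  \<open>c\<close>; after this substitution the terms carrying \<open>u'\<close> cancel.\<close>

lemma harnack_derivative_identity: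
  fixes c :: "'n::finite brk" and u al :: real
  defines "T \<equiv> (2 * u) *\<^sub>R bflow c + c" and "u' \<equiv> 2 * al * u + 1"
    and "d \<equiv> bflow c - al *\<^sub>R c"
  shows "u' * (outer_op c T v \<bullet> v)
      + u * (outer_op d T v \<bullet> v + outer_op c ((2 * u') *\<^sub>R bflow c + (2 * u) *\<^sub>R bflow_deriv c d + d) v \<bullet> v)
    = outer_op T T v \<bullet> v + 2 * u * (outer_op c (pre_act (outer_op c T) c) v \<bullet> v)
      - 2 * u * (outer_op c T v \<bullet> outer_op c c v)"
proof -
  let ?F = "bflow c" let ?P = "outer_op c c" let ?S = "outer_op c T"
  have d: "(2 * u) *\<^sub>R d = T + (- u') *\<^sub>R c"
    by (simp add: d_def T_def u'_def algebra_simps)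
  have F: "(2 * u) *\<^sub>R ?F = T + (-1) *\<^sub>R c" by (simp add: T_def)
  have sym: "outer_op T c = ?S"
    unfolding T_def by (rule outer_op_harnack_commute)
  have ud: "2 * u * (outer_op d T v \<bullet> v) = outer_op T T v \<bullet> v - u' * (?S v \<bullet> v)"
    using arg_cong[OF d, of "\<lambda>x. outer_op x T v \<bullet> v"]
    by (simp add: outer_op_linear outer_op_minus inner_add_left inner_diff_left)
  have cd: "2 * u * (outer_op c d v \<bullet> v) = ?S v \<bullet> v - u' * (?P v \<bullet> v)"
    using arg_cong[OF d, of "\<lambda>x. outer_op c x v \<bullet> v"]
    by (simp add: outer_op_linear outer_op_minus inner_add_left inner_diff_left)
  have cF: "2 * u * (outer_op c ?F v \<bullet> v) = ?S v \<bullet> v - ?P v \<bullet> v"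
    using arg_cong[OF F, of "\<lambda>x. outer_op c x v \<bullet> v"]
    by (simp add: outer_op_linear outer_op_minus inner_add_left inner_diff_left)
  have FT: "2 * u * (outer_op ?F T v \<bullet> v) = outer_op T T v \<bullet> v - ?S v \<bullet> v"
    using arg_cong[OF F, of "\<lambda>x. outer_op x T v \<bullet> v"]
    by (simp add: outer_op_linear outer_op_minus inner_add_left inner_diff_left)
  have "(2 * u) *\<^sub>R bflow_deriv c d = bflow_deriv c T + (- (3 * u')) *\<^sub>R ?F"
    using arg_cong[OF d, of "bflow_deriv c"]
    by (simp only: bflow_deriv_linear bflow_deriv_self) simp
  then have T': "outer_op c ((2 * u') *\<^sub>R ?F + (2 * u) *\<^sub>R bflow_deriv c d + d) v \<bullet> v
      = outer_op c (bflow_deriv c T) v \<bullet> v - u' * (outer_op c ?F v \<bullet> v) + outer_op c d v \<bullet> v"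
    by (simp add: outer_op_linear outer_op_minus inner_add_left inner_diff_left)
  have opS: "(\<lambda>v. outer_op T c v + ?S v) = (\<lambda>v. 2 *\<^sub>R ?S v)"
    by (simp add: sym scaleR_2)
  have Ssa: "?S v \<bullet> w = v \<bullet> ?S w" for v w
    by (metis sym outer_op_adjoint)
  have S2: "(2 *\<^sub>R ?S v) \<bullet> w = v \<bullet> (2 *\<^sub>R ?S w)" for v w
    using Ssa[of v w] by simp
  have DT: "outer_op c (bflow_deriv c T) v \<bullet> v
      = outer_op c (pre_act ?P T) v \<bullet> v + 2 * (outer_op c (pre_act ?S c) v \<bullet> v)
        - ?S v \<bullet> ?P v - 2 * (?P v \<bullet> ?S v)"
    unfolding bflow_deriv_def opS
    by (simp add: outer_op_linear outer_op_minus inner_add_left inner_diff_left pre_act_op_linear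
        outer_op_post_act[OF outer_op_self_adjoint] outer_op_post_act[OF S2])
  \<comment> \<open>The action of \<open>P\<close> on the slots of \<open>T\<close> is moved over to
    \<open>c\<close>, where \<open>pre_act P c\<close> is \<open>F(c) + P c\<close>; this leaves
    \<open>T F(c)\<^sup>*\<close> and a product of \<open>S\<close> and \<open>P\<close>.\<close>
  have "outer_op c (pre_act ?P T) v \<bullet> v = outer_op (pre_act ?P c) T v \<bullet> v"
    by (simp add: outer_op_pre_act[OF linear_outer_op outer_op_self_adjoint])
  also have "pre_act ?P c = ?F + post_act ?P c" by (simp add: bflow_def)
  also have "outer_op \<dots> T v \<bullet> v = outer_op ?F T v \<bullet> v + outer_op T (post_act ?P c) v \<bullet> v"
    using outer_op_adjoint[of "post_act ?P c" T v v]
    by (simp add: outer_op_linear inner_add_left inner_commute[of v])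
  also have "outer_op T (post_act ?P c) v \<bullet> v = ?S v \<bullet> ?P v"
    by (simp add: outer_op_post_act[OF outer_op_self_adjoint] sym)
  finally have PT: "outer_op c (pre_act ?P T) v \<bullet> v = outer_op ?F T v \<bullet> v + ?S v \<bullet> ?P v" .
  have com: "?P v \<bullet> ?S v = ?S v \<bullet> ?P v" by (rule inner_commute)
  \<comment> \<open>The identity is verified after doubling, so that \<open>u\<close> occurs in the
    form \<open>2 * u\<close> required by the equations above.\<close>
  have "2 * (u' * (?S v \<bullet> v) + u * (outer_op d T v \<bullet> v + (outer_op c (bflow_deriv c T) v \<bullet> v
      - u' * (outer_op c ?F v \<bullet> v) + outer_op c d v \<bullet> v)))
    = 2 * u' * (?S v \<bullet> v) + 2 * u * (outer_op d T v \<bullet> v) + 2 * u * (outer_op c (bflow_deriv c T) v \<bullet> v)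
      - u' * (2 * u * (outer_op c ?F v \<bullet> v)) + 2 * u * (outer_op c d v \<bullet> v)"
    by (simp add: algebra_simps)
  also have "\<dots> = 2 * u' * (?S v \<bullet> v) + (outer_op T T v \<bullet> v - u' * (?S v \<bullet> v))
      + (2 * u * (outer_op ?F T v \<bullet> v) + 4 * u * (outer_op c (pre_act ?S c) v \<bullet> v) - 4 * u * (?S v \<bullet> ?P v))
      - u' * (?S v \<bullet> v - ?P v \<bullet> v) + (?S v \<bullet> v - u' * (?P v \<bullet> v))"
    unfolding ud cd cF DT PT com by (simp add: algebra_simps)
  also have "\<dots> = 2 * (outer_op T T v \<bullet> v + 2 * u * (outer_op c (pre_act ?S c) v \<bullet> v)
      - 2 * u * (?S v \<bullet> ?P v))"
    unfolding FT by (simp add: algebra_simps)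
  finally show ?thesis unfolding T' by simp
qed

section \<open>Skew brackets: agreement of the tensor formulas with \<open>binner\<close>,
  \<open>Pop\<close>, \<open>alpha\<close> and \<open>nflow\<close>\<close>

lemma skew_nth: "skew c \<Longrightarrow> c $ j $ i = - c $ i $ j"
  unfolding skew_def by (metis app_bas_bas)

lemma skewI:
  assumes "\<And>i j. c $ j $ i = - c $ i $ j"
  shows "skew c"
  unfolding skew_def
proof (intro allI)
  fix x y
  have "app c x y = (\<Sum>j\<in>UNIV. \<Sum>i\<in>UNIV. (x $ i * y $ j) *\<^sub>R (c $ i $ j))"
    unfolding app_def by (rule sum.swap)
  also have "\<dots> = - app c y x"
    unfolding app_def sum_negf[symmetric]
    by (intro sum.cong refl) (metis assms mult.commute scaleR_minus_right)
  finally show "app c x y = - app c y x" .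
qed

lemma sum_upper_triangle:
  fixes f :: "'n::{finite,linorder} \<Rightarrow> 'n \<Rightarrow> 'a::real_vector"
  assumes sym: "\<And>i j. f i j = f j i" and diag: "\<And>i. f i i = 0"
  shows "(\<Sum>i\<in>UNIV. \<Sum>j\<in>{j. i < j}. f i j) = (1/2) *\<^sub>R (\<Sum>i\<in>UNIV. \<Sum>j\<in>UNIV. f i j)"
proof -
  have lt: "(\<Sum>i\<in>UNIV. \<Sum>j\<in>{j. j < i}. f i j) = (\<Sum>i\<in>UNIV. \<Sum>j\<in>{j. i < j}. f i j)"
    using sum.swap_restrict[of UNIV UNIV f "\<lambda>i j. j < i"] by (simp add: sym)
  have "(\<Sum>j\<in>UNIV. f i j) = (\<Sum>j\<in>{j. i < j}. f i j) + (\<Sum>j\<in>{j. j < i}. f i j)" for i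
  proof -
    have "UNIV = insert i ({j. i < j} \<union> {j. j < i})" by auto
    then have "(\<Sum>j\<in>UNIV. f i j) = (\<Sum>j\<in>insert i ({j. i < j} \<union> {j. j < i}). f i j)" by simp
    also have "\<dots> = (\<Sum>j\<in>{j. i < j} \<union> {j. j < i}. f i j)"
      by (simp add: diag)
    also have "\<dots> = (\<Sum>j\<in>{j. i < j}. f i j) + (\<Sum>j\<in>{j. j < i}. f i j)"
      by (rule sum.union_disjoint) auto
    finally show ?thesis .
  qed
  then show ?thesis
    by (simp add: sum.distrib lt flip: scaleR_2)
qed

lemma skew_diag: "skew c \<Longrightarrow> c $ i $ i = 0"
  using skew_nth[of c i i] by (simp add: vec_eq_iff)

lemma binner_eq:
  assumes "skew c" "skew d"
  shows "binner c d = (c \<bullet> d) / 2"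
proof -
  have "c $ i $ j \<bullet> d $ i $ j = c $ j $ i \<bullet> d $ j $ i" for i j
    by (subst (3 4) skew_nth) (use assms in auto)
  then have "binner c d = (1/2) *\<^sub>R (\<Sum>i\<in>UNIV. \<Sum>j\<in>UNIV. c $ i $ j \<bullet> d $ i $ j)"
    unfolding binner_def app_bas_bas
    by (intro sum_upper_triangle) (simp_all add: skew_diag assms)
  then show ?thesis
    by (simp add: inner_vec_def[of c d] inner_vec_def[of "c $ _" "d $ _"])
qed

lemma Pop_eq:
  assumes "skew c"
  shows "Pop c = outer_op c c"
proof
  fix v
  show "Pop c v = outer_op c c v"
    unfolding Pop_def outer_op_def app_bas_bas
  proof (rule sum_upper_triangle)
    show "(v \<bullet> c $ i $ j) *\<^sub>R c $ i $ j = (v \<bullet> c $ j $ i) *\<^sub>R c $ j $ i" for i j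
      by (subst (3 4) skew_nth[OF assms]) simp
    show "(v \<bullet> c $ i $ i) *\<^sub>R c $ i $ i = 0" for i
      by (simp add: skew_diag[OF assms])
  qed
qed

lemma skew_bflow:
  assumes "skew c"
  shows "skew (bflow c)"
proof (rule skewI)
  fix i j
  have a: "app c x y = - app c y x" for x y using assms unfolding skew_def by blast
  show "bflow c $ j $ i = - bflow c $ i $ j"
    unfolding bflow_def vector_minus_component pre_act_nth post_act_nth
      a[of "outer_op c c (bas j)" "bas i"] a[of "bas j" "outer_op c c (bas i)"]
      skew_nth[OF assms, of j i] linear_neg[OF linear_outer_op]
    by simp
qed

lemma piop_Pop: "skew c \<Longrightarrow> piop (Pop c) c = - bflow c"
  by (simp add: piop_def tens_def Pop_eq bflow_def pre_act_def post_act_def vec_eq_iff)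

lemma skew_uminus: "skew c \<Longrightarrow> skew (- c)"
  by (rule skewI) (metis skew_nth vector_uminus_component)

lemma alpha_eq: "skew c \<Longrightarrow> alpha c = bspeed c"
  by (simp add: alpha_def piop_Pop binner_eq skew_bflow skew_uminus bspeed_def)

lemma nflow_eq: "skew c \<Longrightarrow> nflow c = bflow c - bspeed c *\<^sub>R c"
  by (simp add: nflow_def piop_def tens_def Pop_eq alpha_eq bflow_def pre_act_def post_act_def
      vec_eq_iff app_simps)

section \<open>Continuity of the bracket operations\<close>

lemma continuous_on_app [continuous_intros]:
  "continuous_on S c \<Longrightarrow> continuous_on S x \<Longrightarrow> continuous_on S y
    \<Longrightarrow> continuous_on S (\<lambda>t. app (c t) (x t) (y t))"
  unfolding app_def by (intro continuous_intros)

lemma continuous_on_outer_op [continuous_intros]: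
  "continuous_on S a \<Longrightarrow> continuous_on S b \<Longrightarrow> continuous_on S v
    \<Longrightarrow> continuous_on S (\<lambda>t. outer_op (a t) (b t) (v t))"
  unfolding outer_op_def by (intro continuous_intros)

lemma continuous_on_bflow [continuous_intros]:
  "continuous_on S c \<Longrightarrow> continuous_on S (\<lambda>t. bflow (c t))"
  unfolding bflow_def pre_act_def post_act_def by (intro continuous_intros)

lemma continuous_on_bspeed [continuous_intros]:
  "continuous_on S c \<Longrightarrow> continuous_on S (\<lambda>t. bspeed (c t))"
  unfolding bspeed_def by (intro continuous_intros) auto

section \<open>Nilpotency\<close>

text \<open>The hypothesis \<open>ge\<close> says
  \<open>P\<^sup>2 \<le> c (P \<and> 1 + 1 \<and> P) c\<^sup>*\<close>. It forces
  \<open>[g,g] = [g,[g,g]]\<close>, so the lower central series is stationary from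
  \<open>[g,g]\<close> on, and nilpotency makes it zero.\<close>

lemma nilpotent_bflow_nonneg_imp_zero:
  assumes sk: "skew c" and nil: "nilpotent_br c"
    and ge: "\<And>v. outer_op c (bflow c) v \<bullet> v \<ge> 0"
  shows "c = 0"
proof -
  let ?P = "outer_op c c"
  \<comment> \<open>\<open>W\<close> is \<open>[g,g]\<close> and \<open>W2\<close> is
    \<open>[g,[g,g]]\<close>.\<close>
  define W where "W = span (range (\<lambda>(i, j). c $ i $ j))"
  define W2 where "W2 = span {app c x w | x w. w \<in> W}"
  have cW: "c $ i $ j \<in> W" for i j
    unfolding W_def by (rule span_base) auto
  have appW: "app c x y \<in> W" for x y
    unfolding app_def W_def
    by (intro span_sum span_scale, rule span_base) auto
  have PW: "?P v \<in> W" for v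
    unfolding outer_op_def W_def by (intro span_sum span_scale, rule span_base) auto
  have "W2 \<subseteq> W"
    unfolding W2_def
  proof (rule span_minimal)
    show "{app c x w |x w. w \<in> W} \<subseteq> W" using appW by blast
    show "subspace W" unfolding W_def by (rule subspace_span)
  qed
  have "W \<subseteq> W2"
  proof
    fix w assume "w \<in> W"
    obtain y v where y: "y \<in> span W2" and v: "\<And>w. w \<in> span W2 \<Longrightarrow> orthogonal v w" and w: "w = y + v"
      using orthogonal_subspace_decomp_exists[of W2 w] by metis
    have "y \<in> W2" using y unfolding W2_def span_span .
    have vW: "v \<in> W"
    proof -
      have "y \<in> W" using \<open>y \<in> W2\<close> \<open>W2 \<subseteq> W\<close> by blast
      then have "w - y \<in> W" using \<open>w \<in> W\<close> unfolding W_def by (intro span_diff)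
      then show ?thesis using w by simp
    qed
    have orth: "v \<bullet> app c x z = 0" if "z \<in> W" for x z
    proof -
      have "app c x z \<in> W2" unfolding W2_def using that by (intro span_base) auto
      then have "orthogonal v (app c x z)" by (intro v span_base)
      then show ?thesis by (simp only: orthogonal_def)
    qed
    have "v \<bullet> app c (?P x) z = 0" for x z
    proof -
      have "app c (?P x) z = - app c z (?P x)" using sk unfolding skew_def by blast
      then show ?thesis using orth[OF PW, of z x] by simp
    qed
    \<comment> \<open>Each term brackets with an element of the image of \<open>P\<close>, which
      lies in \<open>W\<close>, and \<open>v\<close> is orthogonal to all such brackets.\<close>
    then have "outer_op c (pre_act ?P c) v \<bullet> v = 0"
      by (simp add: outer_op_inner pre_act_nth inner_add_right orth PW)
    then have "?P v \<bullet> ?P v \<le> 0"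
      using ge[of v] unfolding outer_op_bflow by linarith
    then have "?P v \<bullet> ?P v = 0" using inner_ge_zero[of "?P v"] by linarith
    then have "?P v = 0" by simp
    then have *: "(\<Sum>i\<in>UNIV. \<Sum>j\<in>UNIV. (v \<bullet> c $ i $ j) * (v \<bullet> c $ i $ j)) = 0"
      using outer_op_inner[of c c v v] by simp
    then have 0: "v \<bullet> c $ i $ j = 0" for i j
    proof -
      have "(\<Sum>j\<in>UNIV. (v \<bullet> c $ i $ j) * (v \<bullet> c $ i $ j)) = 0"
        using * by (subst (asm) sum_nonneg_eq_0_iff) (simp_all add: sum_nonneg)
      then have "(v \<bullet> c $ i $ j) * (v \<bullet> c $ i $ j) = 0"
        by (subst (asm) sum_nonneg_eq_0_iff) simp_all
      then show ?thesis by simp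
    qed
    have "orthogonal v v"
      by (rule orthogonal_to_span[OF vW[unfolded W_def]]) (auto simp: orthogonal_def 0)
    then have "v = 0" by (simp add: orthogonal_def)
    then show "w \<in> W2" using w \<open>y \<in> W2\<close> by simp
  qed
  \<comment> \<open>As \<open>W = W2\<close>, the space \<open>W\<close> stays inside the span of
    the \<open>k\<close>-fold brackets for every \<open>k\<close>; for \<open>k = 0\<close> that
    span is everything.\<close>
  have sub: "W \<subseteq> span {iter_br c xs y | xs y. length xs = k}" for k
  proof (induction k)
    case 0
    have "{iter_br c xs y | xs y. length xs = 0} = UNIV" by auto
    then show ?case by simp
  next
    case (Suc k)
    let ?U = "span {iter_br c xs y | xs y. length xs = Suc k}"
    have "app c x w \<in> ?U" if "w \<in> span {iter_br c xs y | xs y. length xs = k}" for x w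
      using that
    proof (induction rule: span_induct_alt)
      case base
      then show ?case by (simp add: app_simps span_zero)
    next
      case (step r z y)
      then obtain xs y' where "z = iter_br c xs y'" "length xs = k" by auto
      then have "app c x z = iter_br c (x # xs) y'" "length (x # xs) = Suc k" by auto
      then have "app c x z \<in> ?U" by (intro span_base) blast
      then show ?case using step by (simp add: app_simps span_add span_scale)
    qed
    then have "W2 \<subseteq> ?U"
      unfolding W2_def using Suc by (intro span_minimal) auto
    then show ?case using \<open>W \<subseteq> W2\<close> by blast
  qed
  obtain k where k: "\<And>xs y. length xs = k \<Longrightarrow> iter_br c xs y = 0"
    using nil by (auto simp: nilpotent_br_def)
  have "{iter_br c xs y | xs y. length xs = k} \<subseteq> {0}" using k by auto
  then have "span {iter_br c xs y | xs y. length xs = k} \<subseteq> {0}"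
    by (intro span_minimal subspace_single_0)
  then have "c $ i $ j = 0" for i j
    using sub[of k] cW[of i j] by blast
  then show ?thesis by (simp add: vec_eq_iff)
qed

text \<open>Iterated brackets are multilinear, and along the flow they evolve by the induced linear action
  of \<open>P - \<alpha> Id\<close>; a Picard iteration on their norm then shows that they stay zero.\<close>

fun iter_br_act :: "'n::finite brk \<Rightarrow> (real ^ 'n \<Rightarrow> real ^ 'n) \<Rightarrow> (real ^ 'n) list \<Rightarrow> real ^ 'n \<Rightarrow> real ^ 'n" where
  "iter_br_act c A [] y = A y"
| "iter_br_act c A (x # xs) y = app c (A x) (iter_br c xs y) + app c x (iter_br_act c A xs y)"

text \<open>\<open>iter_br_act\<close> is a sum of \<open>length zs + 1\<close> terms, each with
  \<open>A\<close> inserted at one argument and so costing a factor \<open>K\<close>. The map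
  \<open>\<Phi>\<close> carries the induction: stripping the outermost bracket replaces
  \<open>\<Phi>\<close> by \<open>\<lambda>w. \<Phi> (app c x w)\<close> and \<open>m\<close> by
  \<open>m * norm x\<close>.\<close>

lemma norm_iter_br_act_le:
  fixes c :: "'n::finite brk"
  assumes "linear \<Phi>" and A: "\<And>x. norm (A x) \<le> K * norm x" and "m \<ge> 0"
    and "\<And>xs y. length xs = length zs \<Longrightarrow>
      norm (\<Phi> (iter_br c xs y)) \<le> m * prod_list (map norm xs) * norm y"
  shows "norm (\<Phi> (iter_br_act c A zs y)) \<le> real (length zs + 1) * K * m * prod_list (map norm zs) * norm y"
  using assms
proof (induction zs arbitrary: \<Phi> m)
  case Nil
  have "norm (\<Phi> (A y)) \<le> m * norm (A y)" using Nil(4)[of "[]" "A y"] by simp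
  also have "\<dots> \<le> m * (K * norm y)" using Nil by (intro mult_left_mono) auto
  finally show ?case by (simp add: mult_ac)
next
  case (Cons x zs)
  have pr: "prod_list (map norm zs) \<ge> 0" by (induction zs) auto
  have lin: "linear (\<lambda>w. \<Phi> (app c x w))"
    using Cons.prems(1) by (auto intro!: linearI simp: app_simps linear_add linear_scale)
  have 1: "norm (\<Phi> (app c (A x) (iter_br c zs y))) \<le> m * (K * norm x) * (prod_list (map norm zs) * norm y)"
  proof -
    have "norm (\<Phi> (iter_br c (A x # zs) y)) \<le> m * prod_list (map norm (A x # zs)) * norm y"
      by (rule Cons.prems(4)) simp
    also have "\<dots> = m * norm (A x) * (prod_list (map norm zs) * norm y)" by simp
    also have "\<dots> \<le> m * (K * norm x) * (prod_list (map norm zs) * norm y)"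
      using Cons.prems(2,3) pr by (intro mult_right_mono mult_left_mono) auto
    finally show ?thesis by simp
  qed
  have 2: "norm (\<Phi> (app c x (iter_br_act c A zs y)))
      \<le> real (length zs + 1) * K * (m * norm x) * prod_list (map norm zs) * norm y"
  proof (rule Cons.IH[OF lin Cons.prems(2)])
    fix xs :: "(real ^ 'n) list" and y' assume "length xs = length zs"
    then show "norm (\<Phi> (app c x (iter_br c xs y'))) \<le> m * norm x * prod_list (map norm xs) * norm y'"
      using Cons.prems(4)[of "x # xs" y'] by (simp add: mult_ac)
  qed (use Cons.prems in auto)
  have "norm (\<Phi> (iter_br_act c A (x # zs) y))
      \<le> norm (\<Phi> (app c (A x) (iter_br c zs y))) + norm (\<Phi> (app c x (iter_br_act c A zs y)))"
    by (simp add: linear_add[OF Cons.prems(1)] norm_triangle_ineq)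
  also note add_mono[OF 1 2]
  finally show ?case by (simp add: algebra_simps)
qed

lemma norm_iter_br_le:
  assumes "\<And>x y. norm (app c x y) \<le> C * norm x * norm y" and "C \<ge> 0"
  shows "norm (iter_br c xs y) \<le> C ^ length xs * prod_list (map norm xs) * norm y"
proof (induction xs)
  case (Cons x xs)
  have "norm (iter_br c (x # xs) y) \<le> C * norm x * norm (iter_br c xs y)" using assms by simp
  also have "\<dots> \<le> C * norm x * (C ^ length xs * prod_list (map norm xs) * norm y)"
    using Cons assms by (intro mult_left_mono) auto
  finally show ?case by (simp add: mult_ac)
qed simp

text \<open>For \<open>c' = - \<pi>(A) c\<close> the terms with \<open>A\<close> applied to an
  intermediate bracket cancel; only \<open>A\<close> on the arguments and \<open>A\<close> on the
  final value remain.\<close>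

lemma has_vector_derivative_iter_br:
  assumes c: "(c has_vector_derivative d) (at s within S)"
    and d: "\<And>x y. app d x y = - (A (app (c s) x y) - app (c s) (A x) y - app (c s) x (A y))"
  shows "((\<lambda>t. iter_br (c t) xs y) has_vector_derivative
    iter_br_act (c s) A xs y - A (iter_br (c s) xs y)) (at s within S)"
proof (induction xs)
  case Nil
  then show ?case by simp
next
  case (Cons x xs)
  show ?case
    using has_vector_derivative_app[OF c has_vector_derivative_const Cons]
    by (simp add: d app_simps algebra_simps)
qed

text \<open>The derivative of a \<open>k\<close>-fold bracket is bounded by \<open>k\<close>-fold
  brackets. Integrating a bound from zero initial data gains a factor \<open>M * t / (r + 1)\<close>
  in round \<open>r\<close>, and the resulting \<open>(M * t) ^ r / fact r\<close> tends to
  zero.\<close>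

lemma iter_br_zero_preserved:
  fixes c :: "real \<Rightarrow> 'n::finite brk"
  assumes c: "\<And>t. t \<ge> 0 \<Longrightarrow> (c has_vector_derivative d t) (at t within {0..})"
    and d: "\<And>t x y. t \<ge> 0 \<Longrightarrow>
      app (d t) x y = - (A t (app (c t) x y) - app (c t) (A t x) y - app (c t) x (A t y))"
    and A: "\<And>t x. t \<ge> 0 \<Longrightarrow> norm (A t x) \<le> K * norm x"
    and bd: "\<And>t x y. t \<ge> 0 \<Longrightarrow> norm (app (c t) x y) \<le> C * norm x * norm y" and "C \<ge> 0" "K \<ge> 0"
    and init: "\<And>xs y. length xs = k \<Longrightarrow> iter_br (c 0) xs y = 0"
    and "t \<ge> 0" "length xs = k"
  shows "iter_br (c t) xs y = 0"
proof -
  \<comment> \<open>There are \<open>k + 1\<close> arguments on which \<open>A\<close> can act, and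
    one further action on the final value.\<close>
  define M where "M = real (k + 2) * K"
  have M: "M \<ge> 0" using \<open>K \<ge> 0\<close> by (simp add: M_def)
  have bound: "norm (iter_br (c t) xs y) \<le> (C ^ k * (M * t) ^ r / fact r) * prod_list (map norm xs) * norm y"
    if "t \<ge> 0" "length xs = k" for r t xs y
    using that
  proof (induction r arbitrary: t xs y)
    case 0
    then show ?case using norm_iter_br_le[OF bd \<open>C \<ge> 0\<close>, of t xs y] by simp
  next
    case (Suc r)
    let ?R = "prod_list (map norm xs) * norm y"
    define D where "D s = iter_br_act (c s) (A s) xs y - A s (iter_br (c s) xs y)" for s
    have der: "((\<lambda>t. iter_br (c t) xs y) has_vector_derivative D s) (at s within {0..t})" if "s \<in> {0..t}" for s
      unfolding D_def
      by (rule has_vector_derivative_within_subset[OF has_vector_derivative_iter_br[OF c d]]) (use that in auto)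
    have Dle: "norm (D s) \<le> M * (C ^ k * (M * s) ^ r / fact r) * ?R" if "s \<ge> 0" for s
    proof -
      define m where "m = C ^ k * (M * s) ^ r / fact r"
      have m: "m \<ge> 0" using M that \<open>C \<ge> 0\<close> by (simp add: m_def)
      have N: "norm (iter_br (c s) xs' y') \<le> m * prod_list (map norm xs') * norm y'"
        if "length xs' = length xs" for xs' y'
        using Suc.IH[OF \<open>s \<ge> 0\<close>, of xs' y'] that Suc.prems by (simp add: m_def)
      have 1: "norm (iter_br_act (c s) (A s) xs y) \<le> real (k + 1) * K * m * prod_list (map norm xs) * norm y"
        using norm_iter_br_act_le[of "\<lambda>x. x" "A s" K m xs "c s" y, OF _ A[OF that] m N] Suc.prems
        by (simp add: linear_id[unfolded id_def])
      have "norm (A s (iter_br (c s) xs y)) \<le> K * norm (iter_br (c s) xs y)" using A that by simp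
      also have "\<dots> \<le> K * (m * prod_list (map norm xs) * norm y)"
        using N[of xs y] \<open>K \<ge> 0\<close> by (intro mult_left_mono) auto
      finally have 2: "norm (A s (iter_br (c s) xs y)) \<le> K * (m * prod_list (map norm xs) * norm y)" .
      have "norm (D s) \<le> norm (iter_br_act (c s) (A s) xs y) + norm (A s (iter_br (c s) xs y))"
        unfolding D_def by (rule norm_triangle_ineq4)
      also note add_mono[OF 1 2]
      also have "real (k + 1) * K * m * prod_list (map norm xs) * norm y
          + K * (m * prod_list (map norm xs) * norm y) = M * m * ?R"
        by (simp add: M_def algebra_simps)
      finally show ?thesis unfolding m_def .
    qed
    show ?case
    proof (cases "t = 0")
      case True
      then show ?thesis using init Suc.prems by simp
    next
      case False
      define \<phi> where "\<phi> s = (C ^ k * (M * s) ^ Suc r / fact (Suc r)) * ?R" for s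
      have "norm (iter_br (c t) xs y - iter_br (c 0) xs y) \<le> \<phi> t - \<phi> 0"
      proof (rule differentiable_bound_general[where f' = D and \<phi>' = "\<lambda>s. M * (C ^ k * (M * s) ^ r / fact r) * ?R"])
        show "0 < t" using False Suc.prems by simp
        show "continuous_on {0..t} (\<lambda>t. iter_br (c t) xs y)"
          using der has_vector_derivative_continuous
          by (fastforce simp: continuous_on_eq_continuous_within)
        show "continuous_on {0..t} \<phi>" unfolding \<phi>_def by (intro continuous_intros) auto
        fix s assume s: "0 < s" "s < t"
        show "((\<lambda>t. iter_br (c t) xs y) has_vector_derivative D s) (at s)"
          using der[of s] s by (simp add: at_within_Icc_at)
        define q where "q = C ^ k * M ^ Suc r / (real (Suc r) * fact r) * ?R"
        have \<phi>: "\<phi> = (\<lambda>s. s ^ Suc r * q)"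
          by (simp add: fun_eq_iff \<phi>_def q_def power_mult_distrib del: of_nat_Suc)
        have "(\<phi> has_real_derivative real (Suc r) * s ^ (Suc r - Suc 0) * q) (at s)"
          unfolding \<phi> by (rule DERIV_cmult_right[OF DERIV_pow])
        also have "real (Suc r) * s ^ (Suc r - Suc 0) * q = M * (C ^ k * (M * s) ^ r / fact r) * ?R"
          by (simp add: q_def power_mult_distrib del: of_nat_Suc)
        finally show "(\<phi> has_vector_derivative M * (C ^ k * (M * s) ^ r / fact r) * ?R) (at s)"
          by (simp add: has_real_derivative_iff_has_vector_derivative)
        show "norm (D s) \<le> M * (C ^ k * (M * s) ^ r / fact r) * ?R" using Dle s by simp
      qed
      then show ?thesis using init Suc.prems by (simp add: \<phi>_def mult_ac)
    qed
  qed
  have "(\<lambda>r. (M * t) ^ r / fact r) \<longlonglongrightarrow> 0"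
    using summable_LIMSEQ_zero[OF summable_exp[of "M * t"]] by (simp add: divide_inverse mult.commute)
  then have "(\<lambda>r. C ^ k * ((M * t) ^ r / fact r) * prod_list (map norm xs) * norm y) \<longlonglongrightarrow> C ^ k * 0 * prod_list (map norm xs) * norm y"
    by (intro tendsto_intros)
  then have "norm (iter_br (c t) xs y) \<le> 0"
    by (intro LIMSEQ_le_const[where X = "\<lambda>r. C ^ k * ((M * t) ^ r / fact r) * prod_list (map norm xs) * norm y"])
       (use bound[OF assms(8,9)] in auto)
  then show ?thesis by simp
qed

section \<open>The flow\<close>

lemma halfline_nondecreasing:
  fixes f :: "real \<Rightarrow> real"
  assumes der: "\<And>t. t \<ge> 0 \<Longrightarrow> (f has_real_derivative f' t) (at t within {0..})"
    and ge: "\<And>t. a < t \<Longrightarrow> t < b \<Longrightarrow> f' t \<ge> 0" and "0 \<le> a" "a \<le> b"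
  shows "f a \<le> f b"
proof (rule DERIV_nonneg_imp_increasing_open[OF \<open>a \<le> b\<close>])
  show "\<exists>y. (f has_real_derivative y) (at x) \<and> 0 \<le> y" if "a < x" "x < b" for x
  proof -
    have "at x within {0..} = at x"
      using that \<open>0 \<le> a\<close> by (intro at_within_interior) simp
    then show ?thesis using der[of x] ge[of x] that \<open>0 \<le> a\<close> by auto
  qed
  have "continuous_on {0..} f"
    using der DERIV_continuous by (fastforce simp: continuous_on_eq_continuous_within)
  then show "continuous_on {a..b} f"
    by (rule continuous_on_subset) (use \<open>0 \<le> a\<close> in auto)
qed

lemma halfline_antiderivative:
  fixes f :: "real \<Rightarrow> real"
  assumes "continuous_on {0..} f"
  obtains g where "g 0 = 0" "\<And>t. t \<ge> 0 \<Longrightarrow> (g has_real_derivative f t) (at t within {0..})"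
proof (rule that[of "\<lambda>x. integral {0..x} f"])
  show "integral {0..0} f = 0" by simp
  fix t :: real assume t: "t \<ge> 0"
  have "((\<lambda>x. integral {0..x} f) has_vector_derivative f t) (at t within {0..t + 1})"
    by (rule integral_has_vector_derivative[OF continuous_on_subset[OF assms]]) (use t in auto)
  moreover have "at t within {0..t + 1} = at t within {0..}"
    by (rule at_within_nhd[of _ "{..<t + 1}"]) auto
  ultimately show "((\<lambda>x. integral {0..x} f) has_real_derivative f t) (at t within {0..})"
    by (simp add: has_real_derivative_iff_has_vector_derivative)
qed

text \<open>The value 2 encodes unit bracket norm, as the full tensor inner product counts each pair
  of indices twice.\<close>

locale bracket_flow =
  fixes c :: "real \<Rightarrow> 'n::finite brk"
  assumes ode: "t \<ge> 0 \<Longrightarrow> (c has_vector_derivative bflow (c t) - bspeed (c t) *\<^sub>R c t) (at t within {0..})"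
    and init_norm: "c 0 \<bullet> c 0 = 2"
begin

lemma continuous_c: "continuous_on {0..} c"
  using ode has_vector_derivative_continuous by (fastforce simp: continuous_on_eq_continuous_within)

lemma speed_antiderivative:
  obtains A where "A 0 = 0" "\<And>t. t \<ge> 0 \<Longrightarrow> (A has_real_derivative 2 * bspeed (c t)) (at t within {0..})"
  using halfline_antiderivative[of "\<lambda>t. 2 * bspeed (c t)"] continuous_c
  by (metis continuous_on_bspeed continuous_on_mult_left)

text \<open>The quantity \<open>c \<bullet> c - 2\<close> solves the linear equation
  \<open>y' = - 2 \<alpha> y\<close> with zero initial value; \<open>exp A\<close> is the
  integrating factor.\<close>

lemma norm_preserved:
  assumes "t \<ge> 0"
  shows "c t \<bullet> c t = 2"
proof -
  obtain A where A: "A 0 = 0" "\<And>t. t \<ge> 0 \<Longrightarrow> (A has_real_derivative 2 * bspeed (c t)) (at t within {0..})"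
    using speed_antiderivative by blast
  define y where "y t = (c t \<bullet> c t - 2) * exp (A t)" for t
  have "(y has_real_derivative 0) (at t within {0..})" if "t \<ge> 0" for t
  proof -
    have "((\<lambda>t. c t \<bullet> c t) has_real_derivative
        (bflow (c t) - bspeed (c t) *\<^sub>R c t) \<bullet> c t + c t \<bullet> (bflow (c t) - bspeed (c t) *\<^sub>R c t)) (at t within {0..})"
      by (rule has_real_derivative_inner[OF ode[OF that] ode[OF that]])
    also have "(bflow (c t) - bspeed (c t) *\<^sub>R c t) \<bullet> c t + c t \<bullet> (bflow (c t) - bspeed (c t) *\<^sub>R c t)
        = 2 * bspeed (c t) * (2 - c t \<bullet> c t)"
      by (simp add: inner_diff_left inner_diff_right bspeed_def inner_commute[of "c t" "bflow _"] algebra_simps)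
    finally show ?thesis
      unfolding y_def by (auto intro!: derivative_eq_intros A(2)[OF that] simp: algebra_simps)
  qed
  then have "y t \<le> y 0 \<and> y 0 \<le> y t"
    using halfline_nondecreasing[of y "\<lambda>_. 0" 0 t]
      halfline_nondecreasing[of "\<lambda>t. - y t" "\<lambda>_. - 0" 0 t, OF DERIV_minus] assms
    by simp
  moreover have "y 0 = 0" by (simp add: y_def init_norm)
  ultimately have "y t = 0" by simp
  then show ?thesis by (simp add: y_def)
qed

text \<open>Variation of constants. If \<open>\<nu> = \<lambda> c\<close> is the solution of the
  unnormalised flow, then \<open>exp A\<close> is \<open>\<lambda>\<^sup>2\<close> and
  \<open>1 / 2 + I\<close> is the unnormalised time, started at \<open>1 / 2\<close>;
  \<open>u\<close> is their product.\<close>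

lemma scale_exists:
  obtains u where "u 0 = 1 / 2" "\<And>t. t \<ge> 0 \<Longrightarrow> u t > 0"
    "\<And>t. t \<ge> 0 \<Longrightarrow> (u has_real_derivative 2 * bspeed (c t) * u t + 1) (at t within {0..})"
proof -
  obtain A where A: "A 0 = 0" "\<And>t. t \<ge> 0 \<Longrightarrow> (A has_real_derivative 2 * bspeed (c t)) (at t within {0..})"
    using speed_antiderivative by blast
  have "continuous_on {0..} (\<lambda>t. exp (- A t))"
    using A(2) DERIV_continuous
    by (intro continuous_intros) (fastforce simp: continuous_on_eq_continuous_within)
  then obtain I where I: "I 0 = 0" "\<And>t. t \<ge> 0 \<Longrightarrow> (I has_real_derivative exp (- A t)) (at t within {0..})"
    using halfline_antiderivative by blast
  have I_ge: "I t \<ge> 0" if "t \<ge> 0" for t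
    using halfline_nondecreasing[of I "\<lambda>t. exp (- A t)" 0 t] I that by simp
  show ?thesis
  proof (rule that[of "\<lambda>t. exp (A t) * (1 / 2 + I t)"])
    show "exp (A 0) * (1 / 2 + I 0) = 1 / 2" by (simp add: A I)
    show "exp (A t) * (1 / 2 + I t) > 0" if "t \<ge> 0" for t
      using I_ge[OF that] by (intro mult_pos_pos) auto
    show "((\<lambda>t. exp (A t) * (1 / 2 + I t)) has_real_derivative
        2 * bspeed (c t) * (exp (A t) * (1 / 2 + I t)) + 1) (at t within {0..})" if "t \<ge> 0" for t
      by (auto intro!: derivative_eq_intros A(2)[OF that] I(2)[OF that] simp: algebra_simps exp_minus)
  qed
qed

end

text \<open>The initial value \<open>u 0 = 1/2\<close> is small enough for \<open>Z \<ge> 0\<close> to hold at time \<open>0\<close>, since \<open>P \<le> 1\<close>.\<close>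

locale scaled_bracket_flow = bracket_flow c for c :: "real \<Rightarrow> 'n::finite brk" +
  fixes u :: "real \<Rightarrow> real"
  assumes u_init: "u 0 = 1 / 2" and u_pos: "t \<ge> 0 \<Longrightarrow> u t > 0"
    and u_ode: "t \<ge> 0 \<Longrightarrow> (u has_real_derivative 2 * bspeed (c t) * u t + 1) (at t within {0..})"
begin

text \<open>By the two differential equations this is \<open>2 u c' + u' c\<close>, which is
  \<open>2 * sqrt u\<close> times the derivative of the rescaled bracket \<open>sqrt u * c\<close>.
  Accordingly \<open>(u P)' = T c\<^sup>*\<close>.\<close>

definition T where "T t = (2 * u t) *\<^sub>R bflow (c t) + c t"

definition Z where "Z t v = u t *\<^sub>R outer_op (c t) (T t) v"

lemma linear_Z: "linear (Z t)"
  unfolding Z_def by (intro linearI) (simp_all add: outer_op_linear scaleR_add_right)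

lemma Z_self_adjoint: "Z t v \<bullet> w = v \<bullet> Z t w"
  using outer_op_adjoint[of "c t" "T t" v w] outer_op_harnack_commute[of "2 * u t" "c t"]
  by (simp add: Z_def T_def)

lemma Z_derivative:
  assumes "t \<ge> 0"
  shows "((\<lambda>t. Z t v \<bullet> v) has_real_derivative
    outer_op (T t) (T t) v \<bullet> v + 2 * (outer_op (c t) (pre_act (Z t) (c t)) v \<bullet> v)
      - 2 * (Z t v \<bullet> outer_op (c t) (c t) v)) (at t within {0..})"
proof -
  note n = has_vector_derivative_vec_nth
  let ?d = "bflow (c t) - bspeed (c t) *\<^sub>R c t" and ?u = "2 * bspeed (c t) * u t + 1"
  let ?T = "(2 * ?u) *\<^sub>R bflow (c t) + (2 * u t) *\<^sub>R bflow_deriv (c t) ?d + ?d"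
  have T': "((\<lambda>t. T t $ i $ j) has_vector_derivative ?T $ i $ j) (at t within {0..})" for i j
  proof -
    have "((\<lambda>t. 2 * u t) has_real_derivative 2 * ?u) (at t within {0..})"
      by (rule DERIV_cmult[OF u_ode[OF assms]])
    from has_vector_derivative_add[OF has_vector_derivative_scaleR[OF this
          has_vector_derivative_bflow_nth[OF ode[OF assms], of i j]] n[OF n[OF ode[OF assms]], of i j]]
    show ?thesis by (simp add: T_def add_ac)
  qed
  have "((\<lambda>t. outer_op (c t) (T t) v) has_vector_derivative
      outer_op ?d (T t) v + outer_op (c t) ?T v + outer_op (c t) (T t) 0) (at t within {0..})"
    by (rule has_vector_derivative_outer_op[OF ode[OF assms] T' has_vector_derivative_const])
  then have "((\<lambda>t. outer_op (c t) (T t) v \<bullet> v) has_real_derivative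
      (outer_op ?d (T t) v + outer_op (c t) ?T v) \<bullet> v) (at t within {0..})"
    using has_real_derivative_inner[OF _ has_vector_derivative_const, of _ _ t "{0..}" v]
    by (fastforce simp: linear_0[OF linear_outer_op])
  from DERIV_mult[OF u_ode[OF assms] this]
  have "((\<lambda>t. Z t v \<bullet> v) has_real_derivative
     ?u * (outer_op (c t) (T t) v \<bullet> v) + u t * (outer_op ?d (T t) v \<bullet> v + outer_op (c t) ?T v \<bullet> v)) (at t within {0..})"
    by (simp add: Z_def inner_add_left algebra_simps)
  also have "?u * (outer_op (c t) (T t) v \<bullet> v) + u t * (outer_op ?d (T t) v \<bullet> v + outer_op (c t) ?T v \<bullet> v)
     = outer_op (T t) (T t) v \<bullet> v + 2 * u t * (outer_op (c t) (pre_act (outer_op (c t) (T t)) (c t)) v \<bullet> v)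
      - 2 * u t * (outer_op (c t) (T t) v \<bullet> outer_op (c t) (c t) v)"
    unfolding T_def by (rule harnack_derivative_identity)
  finally show ?thesis
    by (simp add: Z_def[abs_def] pre_act_op_linear outer_op_linear mult.assoc)
qed

section \<open>The matrix Harnack inequality\<close>

lemma Z_init_nonneg: "Z 0 v \<bullet> v \<ge> 0"
proof -
  let ?c = "c 0" let ?P = "outer_op ?c ?c"
  \<comment> \<open>At \<open>u = 1/2\<close> the operator \<open>T\<close> is
    \<open>F(c) + c\<close>, so the only negative contribution is \<open>- P\<^sup>2\<close>, and
    \<open>P \<ge> P\<^sup>2\<close> compensates it.\<close>
  have "Z 0 v \<bullet> v = (outer_op ?c (pre_act ?P ?c) v \<bullet> v - ?P v \<bullet> ?P v + ?P v \<bullet> v) / 2"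
    by (simp add: Z_def T_def u_init outer_op_linear inner_add_left outer_op_bflow)
  moreover have "outer_op ?c (pre_act ?P ?c) v \<bullet> v \<ge> 0"
    by (rule outer_op_pre_act_nonneg[OF linear_outer_op outer_op_self_nonneg])
  moreover have "?P v \<bullet> ?P v \<le> ?P v \<bullet> v"
    by (rule outer_op_self_contract[OF init_norm])
  ultimately show ?thesis by simp
qed

lemma continuous_u: "continuous_on {0..} u"
  using u_ode DERIV_continuous by (fastforce simp: continuous_on_eq_continuous_within)

text \<open>Maximum principle: at the first time at which the perturbed form vanishes on a unit
  vector, its time derivative is strictly positive, whereas its earlier values were positive. The
  rate 3 exceeds the loss of at most \<open>2 e\<close> caused by the perturbation.\<close>

lemma Z_perturbed_pos:
  assumes "\<epsilon> > 0" "b \<ge> 0" "norm v = 1"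
  shows "Z b v \<bullet> v + \<epsilon> * exp (3 * b) > 0"
proof (rule ccontr)
  assume neg: "\<not> ?thesis"
  define h where "h = (\<lambda>t v. Z t v \<bullet> v + \<epsilon> * exp (3 * t))"
  \<comment> \<open>The set of failures is compact, so there is a failure \<open>(s, w)\<close> with
    earliest time.\<close>
  define K where "K = {p \<in> {0..b} \<times> sphere 0 1. h (fst p) (snd p) \<le> 0}"
  have comp: "compact ({0..b} \<times> (sphere 0 1 :: (real ^ 'n) set))"
    by (intro compact_Times) auto
  have "continuous_on ({0..b} \<times> sphere 0 1) (\<lambda>p. h (fst p) (snd p))"
    unfolding h_def Z_def T_def
    by (intro continuous_intros continuous_on_compose2[OF continuous_c] continuous_on_compose2[OF continuous_u]) auto
  then have "closed K" unfolding K_def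
    by (intro continuous_on_closed_Collect_le continuous_on_const compact_imp_closed[OF comp])
  moreover have "K = K \<inter> ({0..b} \<times> sphere 0 1)" unfolding K_def by auto
  ultimately have "compact K" using comp by (metis closed_Int_compact)
  moreover have "(b, v) \<in> K" using neg assms by (simp add: K_def h_def)
  moreover have "continuous_on K fst" by (intro continuous_intros)
  ultimately obtain p where p: "p \<in> K" "\<And>q. q \<in> K \<Longrightarrow> fst p \<le> fst q"
    using continuous_attains_inf[of K fst] by blast
  obtain s w where sw: "p = (s, w)" by (cases p)
  have s: "0 \<le> s" "s \<le> b" and w: "norm w = 1" and hs: "h s w \<le> 0"
    using p(1) by (auto simp: K_def sw)
  have before: "h t y > 0" if "0 \<le> t" "t < s" "norm y = 1" for t y
  proof (rule ccontr)
    assume "\<not> h t y > 0"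
    then have "(t, y) \<in> K" using that s by (simp add: K_def)
    then show False using p(2)[of "(t, y)"] that by (simp add: sw)
  qed
  have "s \<noteq> 0"
  proof
    assume "s = 0"
    then have "h s w \<ge> \<epsilon>" using Z_init_nonneg[of w] by (simp add: h_def)
    then show False using hs assms(1) by simp
  qed
  then have "s > 0" using s by simp
  define e where "e = \<epsilon> * exp (3 * s)"
  have e: "e > 0" using assms(1) by (simp add: e_def)
  have der: "((\<lambda>t. h t y) has_real_derivative
      outer_op (T s) (T s) y \<bullet> y + 2 * (outer_op (c s) (pre_act (Z s) (c s)) y \<bullet> y)
      - 2 * (Z s y \<bullet> outer_op (c s) (c s) y) + 3 * e) (at s within {0..})" for y
    unfolding h_def e_def
    by (rule DERIV_add[OF Z_derivative[OF s(1)]]) (auto intro!: derivative_eq_intros)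
  have int: "at s within {0..} = at s"
    using \<open>s > 0\<close> by (intro at_within_interior) simp
  have unit_ge: "h s y \<ge> 0" if "norm y = 1" for y
  proof (rule tendsto_lowerbound)
    have "isCont (\<lambda>t. h t y) s" using DERIV_isCont der[of y] int by metis
    then show "((\<lambda>t. h t y) \<longlongrightarrow> h s y) (at_left s)"
      by (auto simp: isCont_def intro: tendsto_within_subset)
    show "\<forall>\<^sub>F t in at_left s. 0 \<le> h t y"
      using eventually_at_left_real[OF \<open>s > 0\<close>]
      by eventually_elim (use before[OF _ _ that] in \<open>auto intro: less_imp_le\<close>)
  qed simp
  define Y where "Y y = Z s y + e *\<^sub>R y" for y
  have linY: "linear Y"
    unfolding Y_def by (intro linear_compose_add linear_Z linear_scale_self)
  have saY: "Y y \<bullet> y' = y \<bullet> Y y'" for y y'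
    using Z_self_adjoint[of s y y'] by (simp add: Y_def inner_add_left inner_add_right)
  have psdY: "Y y \<bullet> y \<ge> 0" for y
  proof (cases "y = 0")
    case False
    define y' where "y' = (1 / norm y) *\<^sub>R y"
    have "norm y' = 1" using False by (simp add: y'_def)
    then have "Y y' \<bullet> y' \<ge> 0"
      using unit_ge[of y'] by (simp add: h_def Y_def e_def inner_add_left dot_square_norm)
    moreover have "Y y \<bullet> y = (norm y)\<^sup>2 * (Y y' \<bullet> y')"
    proof -
      have "y = norm y *\<^sub>R y'" using False by (simp add: y'_def)
      then have "Y y \<bullet> y = Y (norm y *\<^sub>R y') \<bullet> (norm y *\<^sub>R y')" by simp
      then show ?thesis by (simp add: linear_scale[OF linY] power2_eq_square)
    qed
    ultimately show ?thesis by simp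
  qed simp
  have "h s w = 0" using hs unit_ge[OF w] by simp
  then have "Y w \<bullet> w = 0"
    using w by (simp add: h_def Y_def e_def inner_add_left dot_square_norm)
  \<comment> \<open>A null vector of a positive semidefinite form lies in the kernel of its
    operator.\<close>
  then have "(Y w \<bullet> y)\<^sup>2 \<le> 0" for y
    using psd_Cauchy_Schwarz[OF linY saY psdY, of w y] by simp
  then have Yw: "Y w \<bullet> y = 0" for y by simp
  let ?P = "outer_op (c s) (c s)"
  have Zw: "Z s w \<bullet> ?P w = - (e * (?P w \<bullet> w))"
    using Yw[of "?P w"] by (simp add: Y_def inner_add_left inner_commute[of w])
  \<comment> \<open>Replacing \<open>Z\<close> by \<open>Y - e Id\<close> costs \<open>e\<close> in
    each of the two slots.\<close>
  have "pre_act (Z s) (c s) = pre_act Y (c s) + (- 2 * e) *\<^sub>R c s"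
    by (simp add: vec_eq_iff pre_act_nth Y_def app_simps)
  then have "outer_op (c s) (pre_act (Z s) (c s)) w \<bullet> w
      = outer_op (c s) (pre_act Y (c s)) w \<bullet> w - 2 * (e * (?P w \<bullet> w))"
    by (simp add: outer_op_linear outer_op_minus inner_add_left inner_diff_left)
  moreover have "outer_op (c s) (pre_act Y (c s)) w \<bullet> w \<ge> 0"
    by (rule outer_op_pre_act_nonneg[OF linY psdY])
  moreover have "e * (?P w \<bullet> w) \<le> e * 1"
    using outer_op_self_le[of "c s" w] norm_preserved[OF s(1)] w e
    by (intro mult_left_mono) (auto simp: dot_square_norm)
  moreover have "outer_op (T s) (T s) w \<bullet> w \<ge> 0" by (rule outer_op_self_nonneg)
  \<comment> \<open>The slots lose at most \<open>4 e (P w \<bullet> w)\<close>, the product term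
    returns \<open>2 e (P w \<bullet> w)\<close>, and \<open>P \<le> 1\<close>; with
    \<open>3 e\<close> from the perturbation at least \<open>e\<close> remains.\<close>
  ultimately have "outer_op (T s) (T s) w \<bullet> w + 2 * (outer_op (c s) (pre_act (Z s) (c s)) w \<bullet> w)
      - 2 * (Z s w \<bullet> ?P w) + 3 * e > 0"
    using e Zw by linarith
  from has_real_derivative_pos_inc_left[OF der this]
  obtain \<delta> where \<delta>: "\<delta> > 0" "\<And>r. r > 0 \<Longrightarrow> s - r \<in> {0..} \<Longrightarrow> r < \<delta> \<Longrightarrow> h (s - r) w < h s w"
    by blast
  define r where "r = min (s / 2) (\<delta> / 2)"
  have "r > 0" "r < \<delta>" "s - r \<ge> 0" using \<open>s > 0\<close> \<delta>(1) by (auto simp: r_def min_def)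
  then show False
    using \<delta>(2)[of r] before[of "s - r" w] w hs by auto
qed

text \<open>The perturbation is sent to zero at a fixed time; homogeneity then passes from unit
  vectors to all vectors.\<close>

lemma Z_nonneg:
  assumes "t \<ge> 0"
  shows "Z t v \<bullet> v \<ge> 0"
proof -
  have unit: "Z t y \<bullet> y \<ge> 0" if "norm y = 1" for y
  proof (rule field_le_epsilon)
    fix e :: real assume "e > 0"
    then have "Z t y \<bullet> y + e / exp (3 * t) * exp (3 * t) > 0"
      by (intro Z_perturbed_pos assms that) simp
    then show "0 \<le> Z t y \<bullet> y + e" by simp
  qed
  show ?thesis
  proof (cases "v = 0")
    case False
    define y where "y = (1 / norm v) *\<^sub>R v"
    have v: "v = norm v *\<^sub>R y" and "norm y = 1" using False by (simp_all add: y_def)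
    have "Z t v \<bullet> v = Z t (norm v *\<^sub>R y) \<bullet> (norm v *\<^sub>R y)" using v by simp
    also have "\<dots> = (norm v)\<^sup>2 * (Z t y \<bullet> y)"
      by (simp add: linear_scale[OF linear_Z] power2_eq_square)
    finally show ?thesis using unit[OF \<open>norm y = 1\<close>] by simp
  qed simp
qed

section \<open>The trace of \<open>Z\<close> and the energy\<close>

lemma trace_Z:
  assumes "t \<ge> 0"
  shows "(\<Sum>k\<in>UNIV. Z t (bas k) \<bullet> bas k) = u t * (2 * bspeed (c t) * u t + 1)"
proof -
  have "(\<Sum>k\<in>UNIV. Z t (bas k) \<bullet> bas k) = u t * ((c t \<bullet> T t) / 2)"
    by (simp add: Z_def outer_op_trace flip: sum_distrib_left)
  also have "c t \<bullet> T t = 4 * u t * bspeed (c t) + 2"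
    using norm_preserved[OF assms]
    by (simp add: T_def inner_add_right bspeed_def inner_commute[of "c t" "bflow _"])
  finally show ?thesis by (simp add: algebra_simps)
qed

text \<open>The derivative \<open>2 u u'\<close> of \<open>u\<^sup>2\<close> equals
  \<open>2 tr Z\<close> by \<open>trace_Z\<close>, exactly what is needed to absorb the term
  \<open>- 2 tr (Z P) \<ge> - 2 tr Z\<close>.\<close>

definition energy where "energy t = (\<Sum>k\<in>UNIV. Z t (bas k) \<bullet> bas k) + (u t)\<^sup>2"

lemma energy_derivative:
  assumes "t \<ge> 0"
  obtains D where "(energy has_real_derivative D) (at t within {0..})" "D \<ge> (T t \<bullet> T t) / 2"
proof
  let ?c = "c t" let ?P = "outer_op ?c ?c"
  let ?D = "(\<Sum>k\<in>UNIV. outer_op (T t) (T t) (bas k) \<bullet> bas k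
      + 2 * (outer_op ?c (pre_act (Z t) ?c) (bas k) \<bullet> bas k) - 2 * (Z t (bas k) \<bullet> ?P (bas k)))
      + 2 * u t * (2 * bspeed ?c * u t + 1)"
  show "(energy has_real_derivative ?D) (at t within {0..})"
    unfolding energy_def
    by (auto intro!: derivative_eq_intros Z_derivative u_ode assms)
  have "(\<Sum>k\<in>UNIV. outer_op ?c (pre_act (Z t) ?c) (bas k) \<bullet> bas k) \<ge> 0"
    by (intro sum_nonneg outer_op_pre_act_nonneg linear_Z Z_nonneg assms)
  moreover have "(\<Sum>k\<in>UNIV. Z t (bas k) \<bullet> ?P (bas k)) \<le> u t * (2 * bspeed ?c * u t + 1)"
    using trace_mult_outer_op_le[OF linear_Z Z_self_adjoint Z_nonneg[OF assms], of ?c]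
    by (simp add: trace_Z[OF assms] norm_preserved[OF assms])
  moreover have "?D = (T t \<bullet> T t) / 2
      + 2 * (\<Sum>k\<in>UNIV. outer_op ?c (pre_act (Z t) ?c) (bas k) \<bullet> bas k)
      - 2 * (\<Sum>k\<in>UNIV. Z t (bas k) \<bullet> ?P (bas k)) + 2 * (u t * (2 * bspeed ?c * u t + 1))"
    by (simp add: sum.distrib sum_subtractf outer_op_trace[of "T t" "T t"] flip: sum_distrib_left)
  ultimately show "?D \<ge> (T t \<bullet> T t) / 2" by linarith
qed

end

section \<open>Bounds, limits and preservation of nilpotency\<close>

lemma bilinear_eq_sum_bas:
  assumes "bilinear h"
  shows "h x y = (\<Sum>i\<in>UNIV. \<Sum>j\<in>UNIV. (x $ i * y $ j) *\<^sub>R h (bas i) (bas j))"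
proof -
  have "h x y = h (\<Sum>i\<in>UNIV. (x $ i) *\<^sub>R bas i) (\<Sum>j\<in>UNIV. (y $ j) *\<^sub>R bas j)"
    using vec_eq_sum_bas[of x] vec_eq_sum_bas[of y] by simp
  also have "\<dots> = (\<Sum>i\<in>UNIV. \<Sum>j\<in>UNIV. (x $ i * y $ j) *\<^sub>R h (bas i) (bas j))"
    by (simp add: bilinear_sum[OF assms] bilinear_lmul[OF assms] bilinear_rmul[OF assms] sum.cartesian_product
        mult.commute)
  finally show ?thesis .
qed

lemma app_pre_act:
  assumes "linear X"
  shows "app (pre_act X c) x y = app c (X x) y + app c x (X y)"
proof -
  have "bilinear (\<lambda>x y. app c (X x) y + app c x (X y))"
    unfolding bilinear_def using assms
    by (auto intro!: linearI simp: app_simps linear_add linear_scale algebra_simps)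
  from bilinear_eq_sum_bas[OF this, of x y] show ?thesis
    by (simp add: app_def[of "pre_act X c"] pre_act_nth)
qed

lemma app_post_act:
  assumes "linear X"
  shows "app (post_act X c) x y = X (app c x y)"
  by (simp add: app_def post_act_nth linear_sum[OF assms] linear_scale[OF assms])

lemma app_bflow:
  "app (bflow c) x y = app c (outer_op c c x) y + app c x (outer_op c c y) - outer_op c c (app c x y)"
proof -
  have "bflow c = pre_act (outer_op c c) c + (-1) *\<^sub>R post_act (outer_op c c) c"
    by (simp add: bflow_def)
  then show ?thesis
    by (simp only: app_add_brk app_scaleR_brk app_pre_act[OF linear_outer_op] app_post_act[OF linear_outer_op]) simp
qed

lemma norm_app_le:
  fixes c :: "'n::finite brk"
  shows "norm (app c x y) \<le> real CARD('n) * real CARD('n) * norm c * norm x * norm y"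
proof -
  have "norm (app c x y) \<le> (\<Sum>i\<in>UNIV. \<Sum>j\<in>UNIV. norm ((x $ i * y $ j) *\<^sub>R (c $ i $ j)))"
    unfolding app_def by (intro order_trans[OF norm_sum] sum_mono norm_sum)
  also have "\<dots> \<le> (\<Sum>i\<in>(UNIV::'n set). \<Sum>j\<in>(UNIV::'n set). norm x * norm y * norm c)"
  proof (intro sum_mono)
    fix i j
    have "norm (c $ i $ j) \<le> norm c"
      by (rule order_trans[OF Finite_Cartesian_Product.norm_nth_le Finite_Cartesian_Product.norm_nth_le])
    then have "\<bar>x $ i\<bar> * \<bar>y $ j\<bar> * norm (c $ i $ j) \<le> norm x * norm y * norm c"
      by (intro mult_mono component_le_norm_cart mult_nonneg_nonneg) auto
    then show "norm ((x $ i * y $ j) *\<^sub>R (c $ i $ j)) \<le> norm x * norm y * norm c"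
      by (simp add: abs_mult)
  qed
  finally show ?thesis by (simp add: mult_ac)
qed

lemma skew_limit:
  assumes lim: "f \<longlonglongrightarrow> a" and sk: "\<And>n. skew (f n)"
  shows "skew a"
proof (rule skewI)
  fix i j
  have lim': "(\<lambda>n. - f n $ i $ j) \<longlonglongrightarrow> - a $ i $ j"
    by (intro tendsto_minus tendsto_vec_nth lim)
  have "(\<lambda>n. f n $ j $ i) \<longlonglongrightarrow> a $ j $ i"
    by (intro tendsto_vec_nth lim)
  moreover have "(\<lambda>n. f n $ j $ i) = (\<lambda>n. - f n $ i $ j)"
    using skew_nth[OF sk] by blast
  ultimately have "(\<lambda>n. - f n $ i $ j) \<longlonglongrightarrow> a $ j $ i" by (simp only:)
  then show "a $ j $ i = - a $ i $ j"
    using lim' by (rule LIMSEQ_unique)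
qed

lemma continuous_on_iter_br:
  "continuous_on S c \<Longrightarrow> continuous_on S (\<lambda>t. iter_br (c t) xs y)"
  by (induction xs) (auto intro!: continuous_intros)

lemma norm_eq_sqrt2_iff: "norm c = sqrt 2 \<longleftrightarrow> c \<bullet> c = 2"
  by (simp add: norm_eq_sqrt_inner)

lemma bspeed_bounded:
  obtains B where "B \<ge> 0" "\<And>c :: 'n::finite brk. c \<bullet> c = 2 \<Longrightarrow> \<bar>bspeed c\<bar> \<le> B"
proof -
  have "compact (bspeed ` sphere (0 :: 'n brk) (sqrt 2))"
    by (intro compact_continuous_image continuous_intros) auto
  then obtain B where B: "\<And>x. x \<in> bspeed ` sphere (0 :: 'n brk) (sqrt 2) \<Longrightarrow> norm x \<le> B"
    using compact_imp_bounded bounded_iff by metis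
  have "\<bar>bspeed c\<bar> \<le> max B 0" if "c \<bullet> c = 2" for c :: "'n brk"
    using B[of "bspeed c"] that norm_eq_sqrt2_iff[of c] by auto
  then show ?thesis using that[of "max B 0"] by simp
qed

lemma norm_outer_op_self_le:
  assumes "c \<bullet> c = 2"
  shows "norm (outer_op c c x) \<le> norm x"
proof -
  have "outer_op c c x \<bullet> outer_op c c x \<le> x \<bullet> x"
    using outer_op_self_contract[OF assms, of x] outer_op_self_le[of c x] assms by simp
  then show ?thesis by (simp add: norm_le)
qed

context bracket_flow
begin

text \<open>The flow is \<open>c' = - \<pi>(P - \<alpha> Id) c\<close>, an infinitesimal change of
  basis. On the sphere \<open>P\<close> has norm at most 1 and \<alpha> is bounded, so
  \<open>iter_br_zero_preserved\<close> applies.\<close>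

lemma nilpotent_preserved:
  assumes "\<And>xs y. length xs = k \<Longrightarrow> iter_br (c 0) xs y = 0" and "t \<ge> 0" and "length xs = k"
  shows "iter_br (c t) xs y = 0"
proof -
  obtain B where B: "B \<ge> 0" "\<And>c :: 'n brk. c \<bullet> c = 2 \<Longrightarrow> \<bar>bspeed c\<bar> \<le> B"
    using bspeed_bounded by blast
  let ?A = "\<lambda>t x. outer_op (c t) (c t) x - bspeed (c t) *\<^sub>R x"
  show ?thesis
  proof (rule iter_br_zero_preserved[where c = c and A = ?A and K = "1 + B"
        and C = "real CARD('n) * real CARD('n) * sqrt 2", OF ode])
    fix t :: real and x y assume t: "t \<ge> 0"
    have "bflow (c t) - bspeed (c t) *\<^sub>R c t = bflow (c t) + (- bspeed (c t)) *\<^sub>R c t" by simp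
    then show "app (bflow (c t) - bspeed (c t) *\<^sub>R c t) x y =
       - (?A t (app (c t) x y) - app (c t) (?A t x) y - app (c t) x (?A t y))"
      by (simp only: app_add_brk app_scaleR_brk app_bflow) (simp add: app_simps algebra_simps)
    have "norm (?A t x) \<le> norm (outer_op (c t) (c t) x) + norm (bspeed (c t) *\<^sub>R x)"
      by (rule norm_triangle_ineq4)
    also have "\<dots> \<le> norm x + B * norm x"
      using norm_outer_op_self_le[OF norm_preserved[OF t]] B(2)[OF norm_preserved[OF t]]
      by (intro add_mono) (auto intro: mult_right_mono)
    finally show "norm (?A t x) \<le> (1 + B) * norm x" by (simp add: algebra_simps)
    show "norm (app (c t) x y) \<le> real CARD('n) * real CARD('n) * sqrt 2 * norm x * norm y"
      using norm_app_le[of "c t" x y] norm_preserved[OF t] by (simp add: norm_eq_sqrt_inner)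
  qed (use assms B in auto)
qed

end

section \<open>Boundedness of the scale and convergence\<close>

context scaled_bracket_flow
begin

text \<open>Dividing \<open>Z \<ge> 0\<close> by \<open>2 u\<^sup>2\<close> gives
  \<open>F(c) c\<^sup>* + P / (2 u) \<ge> 0\<close>. If \<open>u\<close> were unbounded, the second
  term would disappear in a limit along the sphere, contradicting
  \<open>nilpotent_bflow_nonneg_imp_zero\<close>.\<close>

lemma scale_bounded:
  assumes sk: "\<And>t. t \<ge> 0 \<Longrightarrow> skew (c t)" and nil: "nilpotent_br (c 0)"
  obtains U where "\<And>t. t \<ge> 0 \<Longrightarrow> u t \<le> U"
proof -
  have "\<exists>U. \<forall>t\<ge>0. u t \<le> U"
  proof (rule ccontr)
    assume "\<not> ?thesis"
    then have "\<forall>n. \<exists>t\<ge>0. u t > real (Suc n)" by (meson not_le)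
    then obtain s where s: "\<And>n. s n \<ge> 0" "\<And>n. u (s n) > real (Suc n)" by metis
    have "\<forall>n. c (s n) \<in> sphere 0 (sqrt 2)"
      using norm_preserved[OF s(1)] norm_eq_sqrt2_iff by auto
    then obtain a r where a: "a \<in> sphere 0 (sqrt 2)" and r: "strict_mono r"
      and lim: "((\<lambda>n. c (s n)) \<circ> r) \<longlonglongrightarrow> a"
      by (rule seq_compactE[OF compact_imp_seq_compact[OF compact_sphere]])
    have lim': "(\<lambda>n. f (c (s (r n)))) \<longlonglongrightarrow> f a" if "continuous_on UNIV f" for f :: "'n brk \<Rightarrow> 'b::topological_space"
      using continuous_on_tendsto_compose[OF that lim] by (simp add: o_def)
    have "skew a"
      using lim by (rule skew_limit) (simp add: sk s(1))
    \<comment> \<open>The order \<open>k\<close> is the same at all times, so the vanishing of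
      \<open>k\<close>-fold brackets survives the limit.\<close>
    moreover have "nilpotent_br a"
    proof -
      obtain k where k: "\<And>xs y. length xs = k \<Longrightarrow> iter_br (c 0) xs y = 0"
        using nil by (auto simp: nilpotent_br_def)
      have "iter_br a xs y = 0" if "length xs = k" for xs y
      proof -
        have "(\<lambda>n. iter_br (c (s (r n))) xs y) \<longlonglongrightarrow> iter_br a xs y"
          by (rule lim'[OF continuous_on_iter_br]) (intro continuous_intros)
        moreover have "iter_br (c (s (r n))) xs y = 0" for n
          by (rule nilpotent_preserved[OF k s(1) that])
        ultimately show ?thesis
          by (simp add: LIMSEQ_const_iff)
      qed
      then show ?thesis by (auto simp: nilpotent_br_def)
    qed
    moreover have "outer_op a (bflow a) v \<bullet> v \<ge> 0" for v
    proof (rule LIMSEQ_le)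
      show "(\<lambda>n. - (v \<bullet> v) * inverse (real (Suc n))) \<longlonglongrightarrow> 0"
        using tendsto_mult_right_zero[OF LIMSEQ_inverse_real_of_nat, of "- (v \<bullet> v)"] .
      show "(\<lambda>n. outer_op (c (s (r n))) (bflow (c (s (r n)))) v \<bullet> v) \<longlonglongrightarrow> outer_op a (bflow a) v \<bullet> v"
        by (rule lim') (intro continuous_intros)
      \<comment> \<open>With \<open>P \<le> 1\<close> the Harnack inequality bounds
        \<open>2 u (F(c) c\<^sup>* v \<bullet> v)\<close> below by \<open>- (v \<bullet> v)\<close>,
        and \<open>u\<close> exceeds \<open>n + 1\<close> at these times.\<close>
      have "- (v \<bullet> v) * inverse (real (Suc n)) \<le> outer_op (c (s (r n))) (bflow (c (s (r n)))) v \<bullet> v" for n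
      proof -
        let ?t = "s (r n)" let ?a = "outer_op (c ?t) (bflow (c ?t)) v \<bullet> v"
        have u: "u ?t > 0" by (rule u_pos[OF s(1)])
        have "u ?t * (2 * u ?t * ?a + outer_op (c ?t) (c ?t) v \<bullet> v) \<ge> 0"
          using Z_nonneg[OF s(1), of "r n" v] by (simp add: Z_def T_def outer_op_linear inner_add_left)
        then have "2 * u ?t * ?a + outer_op (c ?t) (c ?t) v \<bullet> v \<ge> 0"
          using u by (simp add: zero_le_mult_iff)
        then have *: "2 * u ?t * ?a + v \<bullet> v \<ge> 0"
          using outer_op_self_le[of "c ?t" v] norm_preserved[OF s(1)] by simp
        show ?thesis
        proof (cases "?a \<ge> 0")
          case True
          moreover have "(v \<bullet> v) * inverse (real (Suc n)) \<ge> 0" by simp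
          ultimately show ?thesis by linarith
        next
          case False
          have "real (Suc n) \<le> 2 * u ?t"
            using s(2)[of "r n"] seq_suble[OF r, of n] u by simp
          then have "2 * u ?t * ?a \<le> real (Suc n) * ?a"
            using False by (intro mult_right_mono_neg) auto
          then have "real (Suc n) * ?a \<ge> - (v \<bullet> v)" using * by linarith
          then show ?thesis by (simp add: field_simps)
        qed
      qed
      then show "\<exists>N. \<forall>n\<ge>N. - (v \<bullet> v) * inverse (real (Suc n)) \<le> outer_op (c (s (r n))) (bflow (c (s (r n)))) v \<bullet> v"
        by blast
    qed
    ultimately have "a = 0" by (rule nilpotent_bflow_nonneg_imp_zero)
    then show False using a by simp
  qed
  then show ?thesis using that by blast
qed

text \<open>The bounds on \<open>u\<close> and \<open>bspeed\<close> bound the energy above, while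
  \<open>T \<bullet> T \<ge> \<delta>\<close> from time \<open>a\<close> on would make it grow at
  rate at least \<open>\<delta> / 2\<close> forever.\<close>

lemma T_arbitrarily_small:
  assumes U: "\<And>t. t \<ge> 0 \<Longrightarrow> u t \<le> U" and "\<delta> > 0" "a \<ge> 0"
  shows "\<exists>t>a. T t \<bullet> T t < \<delta>"
proof (rule ccontr)
  assume "\<not> ?thesis"
  then have ge: "T t \<bullet> T t \<ge> \<delta>" if "t > a" for t using that by force
  obtain B where B: "B \<ge> 0" "\<And>c :: 'n brk. c \<bullet> c = 2 \<Longrightarrow> \<bar>bspeed c\<bar> \<le> B"
    using bspeed_bounded by blast
  define M where "M = U * (2 * B * U + 1) + U\<^sup>2"
  have M: "energy t \<le> M" if t: "t \<ge> 0" for t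
  proof -
    have "bspeed (c t) * u t \<le> B * U"
      using B(2)[OF norm_preserved[OF t]] B(1) U[OF t] u_pos[OF t] by (intro mult_mono) auto
    moreover have "B * U \<ge> 0" using B(1) U[OF t] u_pos[OF t] by simp
    ultimately have "u t * (2 * bspeed (c t) * u t + 1) \<le> u t * (2 * B * U + 1)"
      using u_pos[OF t] by (intro mult_left_mono) auto
    also have "\<dots> \<le> U * (2 * B * U + 1)"
      using U[OF t] \<open>B * U \<ge> 0\<close> by (intro mult_right_mono) auto
    finally show ?thesis
      using U[OF t] u_pos[OF t] unfolding M_def energy_def trace_Z[OF t]
      by (intro add_mono power_mono) auto
  qed
  have "\<exists>D. (energy has_real_derivative D) (at t within {0..}) \<and> D \<ge> (T t \<bullet> T t) / 2" if "t \<ge> 0" for t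
    using energy_derivative[OF that] by blast
  then obtain D where D: "\<And>t. t \<ge> 0 \<Longrightarrow> (energy has_real_derivative D t) (at t within {0..})"
    "\<And>t. t \<ge> 0 \<Longrightarrow> D t \<ge> (T t \<bullet> T t) / 2" by metis
  \<comment> \<open>Over the interval from \<open>a\<close> to \<open>b\<close> the energy would
    gain at least \<open>\<bar>M - energy a\<bar> + 1\<close>, and so exceed
    \<open>M\<close>.\<close>
  define b where "b = a + (2 / \<delta>) * (\<bar>M - energy a\<bar> + 1)"
  have "a \<le> b" using assms by (simp add: b_def)
  have "energy a - \<delta> / 2 * a \<le> energy b - \<delta> / 2 * b"
  proof (rule halfline_nondecreasing[of "\<lambda>t. energy t - \<delta> / 2 * t" "\<lambda>t. D t - \<delta> / 2"])
    show "((\<lambda>t. energy t - \<delta> / 2 * t) has_real_derivative D t - \<delta> / 2) (at t within {0..})" if "t \<ge> 0" for t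
      by (auto intro!: derivative_eq_intros D(1)[OF that])
    show "0 \<le> D t - \<delta> / 2" if "a < t" "t < b" for t
      using D(2)[of t] ge[of t] that assms by simp
  qed fact+
  moreover have "\<delta> / 2 * b = \<delta> / 2 * a + (\<bar>M - energy a\<bar> + 1)"
    using assms by (simp add: b_def algebra_simps)
  moreover have "energy b \<le> M" using M[of b] \<open>a \<le> b\<close> assms by simp
  ultimately show False by linarith
qed

theorem subconverges_to_fixed_point:
  assumes sk: "\<And>t. t \<ge> 0 \<Longrightarrow> skew (c t)" and nil: "nilpotent_br (c 0)"
  shows "\<exists>tl a. strict_mono tl \<and> (\<forall>l. tl l \<ge> 0) \<and> filterlim tl at_top sequentially
    \<and> (\<lambda>l. c (tl l)) \<longlonglongrightarrow> a \<and> a \<bullet> a = 2 \<and> skew a \<and> bflow a = bspeed a *\<^sub>R a"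
proof -
  obtain U where U: "\<And>t. t \<ge> 0 \<Longrightarrow> u t \<le> U" using scale_bounded[OF assms] by blast
  have "\<exists>s. \<forall>n. (s n \<ge> real n \<and> T (s n) \<bullet> T (s n) < inverse (real (Suc n))) \<and> s n < s (Suc n)"
  proof (rule dependent_nat_choice)
    show "\<exists>x\<ge>real 0. T x \<bullet> T x < inverse (real (Suc 0))"
      using T_arbitrarily_small[OF U, of 1 0] by (auto intro: less_imp_le)
    show "\<exists>y. (y \<ge> real (Suc n) \<and> T y \<bullet> T y < inverse (real (Suc (Suc n)))) \<and> x < y" for x n
    proof -
      obtain y where "y > max x (real (Suc n))" "T y \<bullet> T y < inverse (real (Suc (Suc n)))"
        using T_arbitrarily_small[OF U, of "inverse (real (Suc (Suc n)))" "max x (real (Suc n))"] by (auto simp: le_max_iff_disj)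
      then show ?thesis by (intro exI[of _ y]) auto
    qed
  qed
  then obtain s where s: "\<And>n. s n \<ge> real n" "\<And>n. T (s n) \<bullet> T (s n) < inverse (real (Suc n))"
    "\<And>n. s n < s (Suc n)" by blast
  have s0: "s n \<ge> 0" for n using s(1)[of n] by simp
  have "strict_mono s" using s(3) by (simp add: strict_mono_Suc_iff)
  \<comment> \<open>The subsequence is extracted for \<open>c\<close> and \<open>u\<close> jointly,
    so that \<open>T\<close> converges as well.\<close>
  have "compact (sphere (0 :: 'n brk) (sqrt 2) \<times> {0..U})" by (intro compact_Times) auto
  moreover have "\<forall>n. (c (s n), u (s n)) \<in> sphere 0 (sqrt 2) \<times> {0..U}"
    using norm_preserved[OF s0] norm_eq_sqrt2_iff U[OF s0] u_pos[OF s0] by (auto intro: less_imp_le)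
  ultimately obtain p r where p: "p \<in> sphere (0 :: 'n brk) (sqrt 2) \<times> {0..U}" and r: "strict_mono r"
    and lim: "((\<lambda>n. (c (s n), u (s n))) \<circ> r) \<longlonglongrightarrow> p"
    by (rule seq_compactE[OF compact_imp_seq_compact])
  obtain a w where aw: "p = (a, w)" by (cases p)
  have c_lim: "(\<lambda>n. c (s (r n))) \<longlonglongrightarrow> a" and u_lim: "(\<lambda>n. u (s (r n))) \<longlonglongrightarrow> w"
    using tendsto_fst[OF lim] tendsto_snd[OF lim] by (simp_all add: o_def aw)
  have a2: "a \<bullet> a = 2" using p norm_eq_sqrt2_iff[of a] by (auto simp: aw)
  have c_lim': "(\<lambda>n. f (c (s (r n)))) \<longlonglongrightarrow> f a" if "continuous_on UNIV f" for f :: "'n brk \<Rightarrow> 'b::topological_space"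
    using continuous_on_tendsto_compose[OF that c_lim] by simp
  have "skew a"
    using c_lim by (rule skew_limit) (rule sk[OF s0])
  have "(\<lambda>n. T (s (r n))) \<longlonglongrightarrow> (2 * w) *\<^sub>R bflow a + a"
    unfolding T_def by (intro tendsto_intros u_lim c_lim c_lim'[of bflow] continuous_on_bflow continuous_on_id)
  then have "(\<lambda>n. T (s (r n)) \<bullet> T (s (r n))) \<longlonglongrightarrow> ((2 * w) *\<^sub>R bflow a + a) \<bullet> ((2 * w) *\<^sub>R bflow a + a)"
    by (intro tendsto_intros)
  moreover have "(\<lambda>n. T (s (r n)) \<bullet> T (s (r n))) \<longlonglongrightarrow> 0"
  proof (rule tendsto_sandwich[OF _ _ tendsto_const LIMSEQ_inverse_real_of_nat])
    have "T (s (r n)) \<bullet> T (s (r n)) \<le> inverse (real (Suc n))" for n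
    proof -
      have "inverse (real (Suc (r n))) \<le> inverse (real (Suc n))"
        using seq_suble[OF r, of n] by (intro le_imp_inverse_le) auto
      then show ?thesis using s(2)[of "r n"] by linarith
    qed
    then show "\<forall>\<^sub>F n in sequentially. T (s (r n)) \<bullet> T (s (r n)) \<le> inverse (real (Suc n))" by simp
  qed simp
  ultimately have "((2 * w) *\<^sub>R bflow a + a) \<bullet> ((2 * w) *\<^sub>R bflow a + a) = 0"
    by (rule LIMSEQ_unique)
  then have eq: "(2 * w) *\<^sub>R bflow a = - a"
    by (simp add: eq_neg_iff_add_eq_0)
  \<comment> \<open>A limit scale \<open>w = 0\<close> would give \<open>a = 0\<close>, against
    \<open>a \<bullet> a = 2\<close>. Hence \<open>F(a)\<close> is a multiple of \<open>a\<close>,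
    and pairing with \<open>a\<close> identifies the factor as \<open>bspeed a\<close>.\<close>
  have "w \<noteq> 0" using eq a2 by auto
  have "bflow a = (1 / (2 * w)) *\<^sub>R ((2 * w) *\<^sub>R bflow a)" using \<open>w \<noteq> 0\<close> by simp
  also have "\<dots> = (- 1 / (2 * w)) *\<^sub>R a" unfolding eq by simp
  finally have F: "bflow a = (- 1 / (2 * w)) *\<^sub>R a" .
  then have "bspeed a = - 1 / (2 * w)" by (simp add: bspeed_def a2)
  with F have "bflow a = bspeed a *\<^sub>R a" by simp
  moreover have "strict_mono (s \<circ> r)" using \<open>strict_mono s\<close> r by (rule strict_mono_o)
  moreover have "filterlim (s \<circ> r) at_top sequentially"
  proof (rule filterlim_at_top_mono[OF filterlim_real_sequentially])
    have "real n \<le> (s \<circ> r) n" for n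
      using s(1)[of "r n"] seq_suble[OF r, of n] by (simp add: order_trans[OF of_nat_mono])
    then show "\<forall>\<^sub>F n in sequentially. real n \<le> (s \<circ> r) n" by simp
  qed
  ultimately show ?thesis
    using s0 c_lim a2 \<open>skew a\<close> by (intro exI[of _ "s \<circ> r"] exI[of _ a]) simp
qed

end

section \<open>Transfer to the flow defined by \<open>nflow\<close>\<close>

theorem theorem3p14:
  fixes J :: "real ^ ('n::{finite,linorder}) \<Rightarrow> real ^ ('n::{finite,linorder})"
    and mu :: "('n::{finite,linorder}) brk"
    and mut :: "real \<Rightarrow> ('n::{finite,linorder}) brk"
  assumes J_lin: "linear J"
    and J_cx: "\<And>x. J (J x) = - x"
    and J_orth: "\<And>x y. J x \<bullet> J y = x \<bullet> y"
    and mu_C: "in_C J mu"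
    and mu_nil: "nilpotent_br mu"
    and mu_nz: "mu \<noteq> 0"
    and init: "mut 0 = (1 / bnorm mu) *\<^sub>R mu"
    and brk: "\<And>t. t \<ge> 0 \<Longrightarrow> skew (mut t)"
    and ode: "\<And>t. t \<ge> 0 \<Longrightarrow> (mut has_vector_derivative nflow (mut t)) (at t within {0..})"
  shows "\<exists>tl :: nat \<Rightarrow> real. strict_mono tl \<and> (\<forall>l. tl l \<ge> 0) \<and> filterlim tl at_top sequentially \<and>
           (\<exists>nu. ((\<lambda>l. mut (tl l)) \<longlonglongrightarrow> nu) \<and> nu \<noteq> 0 \<and> nflow nu = 0)"
proof -
  have "skew mu" using mu_C by (simp only: in_C_def)
  then have bn: "bnorm mu = sqrt ((mu \<bullet> mu) / 2)" by (simp add: bnorm_def binner_eq)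
  \<comment> \<open>Dividing by \<open>bnorm mu\<close>, whose square is half of
    \<open>mu \<bullet> mu\<close>, produces the normalisation 2.\<close>
  have "mut 0 \<bullet> mut 0 = 2"
    using mu_nz by (simp add: init bn power2_eq_square[symmetric] real_sqrt_pow2 field_simps)
  then interpret bracket_flow mut
    using ode nflow_eq[OF brk] by unfold_locales auto
  obtain u where u: "u 0 = 1 / 2" "\<And>t. t \<ge> 0 \<Longrightarrow> u t > 0"
    "\<And>t. t \<ge> 0 \<Longrightarrow> (u has_real_derivative 2 * bspeed (mut t) * u t + 1) (at t within {0..})"
    using scale_exists by blast
  interpret scaled_bracket_flow mut u
    by unfold_locales (use u in auto)
  \<comment> \<open>Iterated brackets are homogeneous in the bracket, so the normalised initial
    bracket is nilpotent too.\<close>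
  have iter: "iter_br (k *\<^sub>R mu) xs y = (k ^ length xs) *\<^sub>R iter_br mu xs y" for k xs y
    by (induction xs) (simp_all add: app_scaleR_brk app_simps mult.commute)
  have "nilpotent_br (mut 0)"
    using mu_nil unfolding nilpotent_br_def init iter by (metis scaleR_zero_right)
  from subconverges_to_fixed_point[OF brk this]
  obtain tl a where *: "strict_mono tl" "\<forall>l. tl l \<ge> 0" "filterlim tl at_top sequentially"
    "(\<lambda>l. mut (tl l)) \<longlonglongrightarrow> a" "a \<bullet> a = 2" "skew a" "bflow a = bspeed a *\<^sub>R a" by blast
  moreover have "a \<noteq> 0" using *(5) by auto
  moreover have "nflow a = 0" using *(6,7) by (simp add: nflow_eq)
  ultimately show ?thesis by blast
qed

end
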